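(* Every vertebrate graph is 1-guardable.
   Context: Cops and robber game on a finite simple connected graph $G$: cops are placed on vertices, then the robber; players alternate moves, each cop (resp. the robber) either staying or moving to an adjacent vertex; the robber is captured when a cop occupies its vertex. An induced subgraph $H$ of $G$ is isometric if $d_H(u,v)=d_G(u,v)$ for all $u,v\in V(H)$. One cop guards $H$ in $G$ if, after finitely many moves, the cop can move within $H$ so that whenever the robber moves into $H$ at some round $t$, it is captured at round $t+1$. A graph $H$ is 1-guardable if one cop can guard $H$ in every graph $G$ containing $H$ as an isometric subgraph. Notation: $d$ is graph distance, $N(x)$ the neighbourhood, $N[x]=N(x)\cup\{x\}$; for $d(c,x)\ge 2$, $N(c,x)=\{v\in N(c): d(c,x)=1+d(v,x)\}$ and $N_B(c,x)=N(c,x)\cap V(B)$. A block graph is a connected graph all of whose blocks (maximal 2-connected subgraphs) are complete; an extended block graph is obtained from a block graph by replacing each cut vertex by a clique, each clique vertex joined to all neighbours of the cut vertex. A simple connected graph $H$ is vertebrate if it has an induced subgraph $B$ that is an extended block graph such that for all $c\in V(B)$, $x\in V(H)$ with $d(c,x)\ge 2$ there is $c'\in N_B(c,x)$ with $N[c']\supseteq N[v]$ for all $v\in N(c,x)$ (distances and neighbourhoods taken in $H$). *)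

theory Defs
  imports "Graph_Theory.Graph_Theory"
begin

text \<open>
  Finite simple graphs are the graphs of the library locale \<open>graph\<close>: finite, symmetric digraphs
  without loops and multiple arcs. The library predicate \<^const>\<open>connected\<close> excludes the empty graph.
\<close>

definition gdist :: "('a, 'b) pre_digraph \<Rightarrow> 'a \<Rightarrow> 'a \<Rightarrow> ereal" where
  "gdist G u v = wf_digraph.\<mu> G (\<lambda>_. 1) u v"

definition nbhd :: "('a, 'b) pre_digraph \<Rightarrow> 'a \<Rightarrow> 'a set" where
  "nbhd G x = {v. x \<rightarrow>\<^bsub>G\<^esub> v}"

definition closed_nbhd :: "('a, 'b) pre_digraph \<Rightarrow> 'a \<Rightarrow> 'a set" where
  "closed_nbhd G x = insert x (nbhd G x)"

definition nbhd_towards :: "('a, 'b) pre_digraph \<Rightarrow> 'a \<Rightarrow> 'a \<Rightarrow> 'a set" where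
  "nbhd_towards G c x = {v \<in> nbhd G c. gdist G c x = 1 + gdist G v x}"

definition isometric_subgraph :: "('a, 'b) pre_digraph \<Rightarrow> ('a, 'b) pre_digraph \<Rightarrow> bool" where
  "isometric_subgraph H G \<longleftrightarrow>
     induced_subgraph H G \<and> (\<forall>u\<in>verts H. \<forall>v\<in>verts H. gdist H u v = gdist G u v)"


subsection \<open>The game with one cop\<close>

text \<open>
  In round \<open>0\<close> the cop and then the robber choose a vertex; in every later round the cop moves and
  then the robber moves. A robber play is the sequence of the robber's positions at the end of
  rounds \<open>0, 1, 2, \<dots>\<close>. A cop strategy maps the list of the robber's positions in
  the rounds before \<open>t\<close> to the cop's position in round \<open>t\<close>.
\<close>

definition legal_step :: "('a, 'b) pre_digraph \<Rightarrow> 'a \<Rightarrow> 'a \<Rightarrow> bool" where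
  "legal_step G u v \<longleftrightarrow> u \<in> verts G \<and> v \<in> closed_nbhd G u"

definition robber_play :: "('a, 'b) pre_digraph \<Rightarrow> (nat \<Rightarrow> 'a) \<Rightarrow> bool" where
  "robber_play G r \<longleftrightarrow> (\<forall>t. legal_step G (r t) (r (Suc t)))"

definition cop_pos :: "('a list \<Rightarrow> 'a) \<Rightarrow> (nat \<Rightarrow> 'a) \<Rightarrow> nat \<Rightarrow> 'a" where
  "cop_pos \<sigma> r t = \<sigma> (map r [0..<t])"

definition cop_strategy :: "('a, 'b) pre_digraph \<Rightarrow> ('a list \<Rightarrow> 'a) \<Rightarrow> bool" where
  "cop_strategy G \<sigma> \<longleftrightarrow>
     (\<forall>r. robber_play G r \<longrightarrow> (\<forall>t. legal_step G (cop_pos \<sigma> r t) (cop_pos \<sigma> r (Suc t))))"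

text \<open>
  The robber is captured by the end of round \<open>t\<close> if in some round up to \<open>t\<close> it moved (or was placed)
  onto the cop's vertex, or the cop moved onto the vertex the robber occupied since the previous
  round.
\<close>

definition captured :: "('a list \<Rightarrow> 'a) \<Rightarrow> (nat \<Rightarrow> 'a) \<Rightarrow> nat \<Rightarrow> bool" where
  "captured \<sigma> r t \<longleftrightarrow>
     (\<exists>s\<le>t. cop_pos \<sigma> r s = r s) \<or> (\<exists>s<t. cop_pos \<sigma> r (Suc s) = r s)"

text \<open>
  The robber counts as having moved into \<open>H\<close> at round \<open>t\<close> whenever its position after its move of
  that round lies in \<open>H\<close>, so a robber that is already in \<open>H\<close> must be captured as well. The game
  ends with the capture, so nothing is demanded of the cop afterwards.
\<close>

definition one_cop_guards :: "('a, 'b) pre_digraph \<Rightarrow> ('a, 'b) pre_digraph \<Rightarrow> bool" where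
  "one_cop_guards H G \<longleftrightarrow>
     (\<exists>\<sigma> n. cop_strategy G \<sigma> \<and>
        (\<forall>r. robber_play G r \<longrightarrow>
           (\<forall>t\<ge>n. \<not> captured \<sigma> r t \<longrightarrow>
              cop_pos \<sigma> r t \<in> verts H \<and>
              (r t \<in> verts H \<longrightarrow> cop_pos \<sigma> r (Suc t) = r t))))"

text \<open>
  ``Containing \<open>H\<close>'' is meant up to isomorphism, so the host graphs \<open>G\<close> may use vertex and arc
  types different from those of \<open>H\<close>; the type argument names them. Every finite graph is
  represented as soon as both types are infinite.
\<close>

definition one_guardable :: "('c \<times> 'd) itself \<Rightarrow> ('a, 'b) pre_digraph \<Rightarrow> bool" where
  "one_guardable _ H \<longleftrightarrow>
     (\<forall>(G :: ('c, 'd) pre_digraph) K.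
        graph G \<and> connected G \<and> digraph_iso H K \<and> isometric_subgraph K G \<longrightarrow>
        one_cop_guards K G)"


subsection \<open>Extended block graphs\<close>

definition cut_vertex :: "('a, 'b) pre_digraph \<Rightarrow> 'a \<Rightarrow> bool" where
  "cut_vertex G v \<longleftrightarrow> v \<in> verts G \<and>
     (\<exists>u\<in>verts G - {v}. \<exists>w\<in>verts G - {v}.
        u \<rightarrow>\<^sup>*\<^bsub>G\<^esub> w \<and> \<not> u \<rightarrow>\<^sup>*\<^bsub>pre_digraph.del_vert G v\<^esub> w)"

text \<open>
  As usual for blocks, \<open>2\<close>-connected means connected without a cut vertex, so that single vertices
  and single edges are admitted. These are complete, so the notion of block graph does not depend
  on this convention.
\<close>

definition two_connected :: "('a, 'b) pre_digraph \<Rightarrow> bool" where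
  "two_connected G \<longleftrightarrow> graph G \<and> connected G \<and> (\<forall>v. \<not> cut_vertex G v)"

definition block_of :: "('a, 'b) pre_digraph \<Rightarrow> ('a, 'b) pre_digraph \<Rightarrow> bool" where
  "block_of D G \<longleftrightarrow> pre_digraph.max_subgraph G two_connected D"

definition block_graph :: "('a, 'b) pre_digraph \<Rightarrow> bool" where
  "block_graph G \<longleftrightarrow> graph G \<and> connected G \<and>
     (\<forall>D. block_of D G \<longrightarrow> complete_digraph (card (verts D)) D)"

text \<open>
  The map \<open>\<pi>\<close> sends every vertex of the extended graph \<open>B\<close> to the vertex of the block graph \<open>T\<close>
  it replaces: the fibre over a cut vertex is the (nonempty) clique substituted for it, the fibre
  over any other vertex is a single vertex. Since \<open>T\<close> is isomorphic to the subgraph of \<open>B\<close> induced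
  by one vertex from each fibre, it may be taken over the same types as \<open>B\<close>.
\<close>

definition clique_replacement ::
    "('a \<Rightarrow> 'a) \<Rightarrow> ('a, 'b) pre_digraph \<Rightarrow> ('a, 'b) pre_digraph \<Rightarrow> bool" where
  "clique_replacement \<pi> T B \<longleftrightarrow>
     \<pi> ` verts B = verts T \<and>
     (\<forall>x\<in>verts T. \<not> cut_vertex T x \<longrightarrow> (\<exists>!u. u \<in> verts B \<and> \<pi> u = x)) \<and>
     (\<forall>u\<in>verts B. \<forall>v\<in>verts B.
        u \<rightarrow>\<^bsub>B\<^esub> v \<longleftrightarrow> u \<noteq> v \<and> (\<pi> u = \<pi> v \<or> \<pi> u \<rightarrow>\<^bsub>T\<^esub> \<pi> v))"

definition extended_block_graph :: "('a, 'b) pre_digraph \<Rightarrow> bool" where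
  "extended_block_graph B \<longleftrightarrow> graph B \<and>
     (\<exists>(T :: ('a, 'b) pre_digraph) \<pi>. block_graph T \<and> clique_replacement \<pi> T B)"


subsection \<open>Vertebrate graphs\<close>

definition vertebrate :: "('a, 'b) pre_digraph \<Rightarrow> bool" where
  "vertebrate H \<longleftrightarrow> graph H \<and> connected H \<and>
     (\<exists>B. induced_subgraph B H \<and> extended_block_graph B \<and>
        (\<forall>c\<in>verts B. \<forall>x\<in>verts H. gdist H c x \<ge> 2 \<longrightarrow>
           (\<exists>c'\<in>nbhd_towards H c x \<inter> verts B.
              \<forall>v\<in>nbhd_towards H c x. closed_nbhd H v \<subseteq> closed_nbhd H c')))"

end

theory Submission
  imports Defs
begin

text \<open>
  For \<open>c \<in> B\<close> and \<open>x\<close> with \<open>d c x \<ge> 2\<close>, call \<open>c'\<close> as in the definition of a vertebrate graph a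
  gate from \<open>c\<close> towards \<open>x\<close>. Gates show that every vertex of \<open>H\<close> is dominated by a vertex of \<open>B\<close>,
  so walks of \<open>H\<close> can be folded onto walks of \<open>B\<close>. In an extended block graph, two nonadjacent
  neighbours of \<open>c\<close> are separated by the clique that \<open>c\<close> belongs to. Folding a geodesic from \<open>x\<close> to
  \<open>y\<close> therefore shows that the gates from \<open>c\<close> towards \<open>x\<close> and \<open>y\<close> are equal or adjacent when
  \<open>d x y < d c x + d c y\<close>; if even \<open>d x y + 2 \<le> d c x + d c y\<close>, then each of the two gates leads
  towards both \<open>x\<close> and \<open>y\<close>.

  Let the robber be at \<open>r\<close> and let \<open>M\<close> be the maximum of \<open>d c x - d r x\<close> over \<open>x \<in> H\<close>. As long as
  \<open>M \<ge> 1\<close>, the cop moves to a gate towards a vertex where this maximum is attained. Because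
  \<open>d x y \<le> d r x + d r y\<close>, the statements about gates show that the move lowers the maximum, and the
  robber can at best restore it. While \<open>M \<ge> 2\<close> stays constant, consecutive steps of the cop go
  straight on, so its path is a geodesic of \<open>B\<close> and must end. Once \<open>M \<le> 1\<close>, a robber that enters
  \<open>H\<close> is at distance at most \<open>1\<close> from the cop.
\<close>

lemma nonincreasing_upto:
  fixes f :: "nat \<Rightarrow> nat"
  assumes "\<And>s. s < t \<Longrightarrow> f (Suc s) \<le> f s" and "i \<le> j" "j \<le> t"
  shows "f j \<le> f i"
  using assms(2,3)
proof (induction rule: dec_induct)
  case (step n)
  then show ?case using assms(1)[of n] by simp
qed simp

section \<open>The pursuit game on an abstract distance\<close>

text \<open>A host graph reduced to its distance: \<open>V\<close> holds the vertices of the host,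
  \<open>H\<close> those of the isometric copy, \<open>B\<close> those of its extended block graph.
  Isometry lets one \<open>d\<close> serve for both \<open>V\<close> and \<open>H\<close>.
  \<open>ex_gate\<close> is the vertebrate condition. \<open>separation\<close> concerns walks in
  \<open>B\<close> that avoid every vertex with the same closed neighbourhood in \<open>B\<close> as
  \<open>c\<close>; avoiding \<open>c\<close> alone would not do, since \<open>c\<close> may lie in
  a clique that replaces a cut vertex.\<close>

locale spine =
  fixes V H B :: "'a set" and d :: "'a \<Rightarrow> 'a \<Rightarrow> nat"
  assumes finite_V: "finite V" and H_subset: "H \<subseteq> V" and B_subset: "B \<subseteq> H"
    and d_eq_0: "\<And>x y. x \<in> V \<Longrightarrow> y \<in> V \<Longrightarrow> d x y = 0 \<longleftrightarrow> x = y"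
    and d_sym: "\<And>x y. x \<in> V \<Longrightarrow> y \<in> V \<Longrightarrow> d x y = d y x"
    and d_triangle: "\<And>x y z. x \<in> V \<Longrightarrow> y \<in> V \<Longrightarrow> z \<in> V \<Longrightarrow> d x z \<le> d x y + d y z"
    and first_step: "\<And>x y. x \<in> H \<Longrightarrow> y \<in> H \<Longrightarrow> x \<noteq> y \<Longrightarrow>
          \<exists>z\<in>H. d x z = 1 \<and> d x y = Suc (d z y)"
    and ex_gate: "\<And>c x. c \<in> B \<Longrightarrow> x \<in> H \<Longrightarrow> d c x \<ge> 2 \<Longrightarrow>
          \<exists>g\<in>B. d c g = 1 \<and> d c x = Suc (d g x) \<and>
            (\<forall>v\<in>H. d c v = 1 \<and> d c x = Suc (d v x) \<longrightarrow>
               (\<forall>u\<in>H. d v u \<le> 1 \<longrightarrow> d g u \<le> 1))"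
    and separation: "\<And>c a b. c \<in> B \<Longrightarrow> a \<in> B \<Longrightarrow> b \<in> B \<Longrightarrow> d c a = 1 \<Longrightarrow> d c b = 1 \<Longrightarrow> d a b \<ge> 2 \<Longrightarrow>
          \<not> (\<lambda>u v. u \<in> B \<and> v \<in> B \<and> d u v \<le> 1 \<and>
               (\<exists>t\<in>B. (d u t \<le> 1) \<noteq> (d c t \<le> 1)) \<and> (\<exists>t\<in>B. (d v t \<le> 1) \<noteq> (d c t \<le> 1)))\<^sup>*\<^sup>* a b"
begin

definition covers :: "'a \<Rightarrow> 'a \<Rightarrow> bool" where
  "covers z w \<longleftrightarrow> z \<in> H \<and> w \<in> H \<and> (\<forall>u\<in>H. d w u \<le> 1 \<longrightarrow> d z u \<le> 1)"

definition towards :: "'a \<Rightarrow> 'a \<Rightarrow> 'a set" where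
  "towards c x = {v \<in> H. d c v = 1 \<and> d c x = Suc (d v x)}"

definition gate :: "'a \<Rightarrow> 'a \<Rightarrow> 'a \<Rightarrow> bool" where
  "gate c x g \<longleftrightarrow> c \<in> B \<and> x \<in> H \<and> d c x \<ge> 2 \<and> g \<in> B \<and> g \<in> towards c x \<and> (\<forall>v\<in>towards c x. covers g v)"

text \<open>Closed neighbourhoods are compared within \<open>B\<close> only, so twins may see
  different parts of \<open>H\<close>. Vertices that replace the same vertex of the block graph are
  twins.\<close>

definition twins :: "'a \<Rightarrow> 'a \<Rightarrow> bool" where
  "twins c z \<longleftrightarrow> (\<forall>t\<in>B. d z t \<le> 1 \<longleftrightarrow> d c t \<le> 1)"

definition avoiding :: "'a \<Rightarrow> 'a \<Rightarrow> 'a \<Rightarrow> bool" where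
  "avoiding c u v \<longleftrightarrow> u \<in> B \<and> v \<in> B \<and> d u v \<le> 1 \<and> \<not> twins c u \<and> \<not> twins c v"

lemma H_V: "x \<in> H \<Longrightarrow> x \<in> V" and B_H: "x \<in> B \<Longrightarrow> x \<in> H" and B_V: "x \<in> B \<Longrightarrow> x \<in> V"
  using H_subset B_subset by auto

lemma d_self [simp]: "x \<in> V \<Longrightarrow> d x x = 0"
  using d_eq_0 by simp

lemma d_triangle_H: "x \<in> H \<Longrightarrow> y \<in> H \<Longrightarrow> z \<in> H \<Longrightarrow> d x z \<le> d x y + d y z"
  using d_triangle H_V by blast

lemma d_sym_H: "x \<in> H \<Longrightarrow> y \<in> H \<Longrightarrow> d x y = d y x"
  using d_sym H_V by blast

lemma not_avoiding:
  assumes "c \<in> B" "a \<in> B" "b \<in> B" "d c a = 1" "d c b = 1" "d a b \<ge> 2"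
  shows "\<not> (avoiding c)\<^sup>*\<^sup>* a b"
proof -
  have "avoiding c = (\<lambda>u v. u \<in> B \<and> v \<in> B \<and> d u v \<le> 1 \<and>
      (\<exists>t\<in>B. (d u t \<le> 1) \<noteq> (d c t \<le> 1)) \<and> (\<exists>t\<in>B. (d v t \<le> 1) \<noteq> (d c t \<le> 1)))"
    unfolding avoiding_def twins_def by (intro ext) auto
  with separation[OF assms] show ?thesis by simp
qed

lemma coversD:
  assumes "covers z w"
  shows "z \<in> H" "w \<in> H" "\<And>u. u \<in> H \<Longrightarrow> d w u \<le> 1 \<Longrightarrow> d z u \<le> 1" "d z w \<le> 1"
  using assms H_V by (auto simp: covers_def)

lemma twinsD: "twins c z \<Longrightarrow> t \<in> B \<Longrightarrow> d z t \<le> 1 \<longleftrightarrow> d c t \<le> 1"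
  by (simp add: twins_def)

lemma towardsD:
  assumes "v \<in> towards c x"
  shows "v \<in> H" "d c v = 1" "d c x = Suc (d v x)"
  using assms by (auto simp: towards_def)

lemma gateD:
  assumes "gate c x g"
  shows "c \<in> B" "x \<in> H" "d c x \<ge> 2" "g \<in> B" "g \<in> towards c x" "d c g = 1" "d c x = Suc (d g x)"
    "\<And>v. v \<in> towards c x \<Longrightarrow> covers g v"
  using assms by (auto simp: gate_def towards_def)

lemma obtain_gate:
  assumes "c \<in> B" "x \<in> H" "d c x \<ge> 2"
  obtains g where "gate c x g"
proof -
  from ex_gate[OF assms] obtain g where g: "g \<in> B" "d c g = 1" "d c x = Suc (d g x)"
    "\<forall>v\<in>H. d c v = 1 \<and> d c x = Suc (d v x) \<longrightarrow> (\<forall>u\<in>H. d v u \<le> 1 \<longrightarrow> d g u \<le> 1)" by blast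
  then have "gate c x g" using assms B_H by (auto simp: gate_def towards_def covers_def)
  then show ?thesis using that by blast
qed

lemma towardsI:
  assumes "c \<in> H" "x \<in> H" "v \<in> H" "d c v \<le> 1" "d v x < d c x"
  shows "v \<in> towards c x"
proof -
  have "d c x \<le> d c v + d v x" using assms d_triangle_H by blast
  then show ?thesis using assms by (auto simp: towards_def)
qed

section \<open>Domination by vertices of \<open>B\<close> and folding of walks\<close>

text \<open>The second vertex of a geodesic from \<open>w\<close> to \<open>x\<close> lies in the
  closed neighbourhood of \<open>w\<close>, hence in that of \<open>z\<close>. The case
  \<open>x = w\<close> must be excluded, because \<open>z\<close> may be a proper neighbour of
  \<open>w\<close>.\<close>

lemma covers_closer:
  assumes "covers z w" "x \<in> H" "x \<noteq> w"
  shows "d z x \<le> d w x"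
proof -
  note D = coversD[OF assms(1)]
  obtain u where u: "u \<in> H" "d w u = 1" "d w x = Suc (d u x)"
    using first_step[OF D(2) assms(2)] assms(3) by blast
  have "d z u \<le> 1" using D u by simp
  moreover have "d z x \<le> d z u + d u x" using D u assms d_triangle_H by blast
  ultimately show ?thesis using u by simp
qed

text \<open>Following gates towards \<open>w\<close> stays in \<open>B\<close> and shortens the
  distance until it is at most 1.\<close>

lemma near_B:
  assumes "c \<in> B" "w \<in> H"
  shows "\<exists>c\<in>B. d c w \<le> 1"
  using assms(1)
proof (induction "d c w" arbitrary: c rule: less_induct)
  case less
  show ?case
  proof (cases "d c w \<le> 1")
    case False
    then obtain g where "gate c w g" using less assms obtain_gate by (metis not_less_eq_eq numeral_2_eq_2 One_nat_def)
    then show ?thesis using less(1) gateD(4,7) by (metis lessI)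
  qed (use less in blast)
qed

text \<open>Take \<open>c\<close> in \<open>B\<close> within distance 1 of \<open>w\<close>. If it
  does not cover \<open>w\<close>, some \<open>u\<close> in the closed neighbourhood of
  \<open>w\<close> is not in that of \<open>c\<close>; then \<open>w\<close> is a first step from
  \<open>c\<close> towards \<open>u\<close>, so the gate towards \<open>u\<close> covers
  \<open>w\<close>.\<close>

lemma obtain_covering:
  assumes "c \<in> B" "w \<in> H"
  obtains z where "z \<in> B" "covers z w"
proof -
  obtain c where c: "c \<in> B" "d c w \<le> 1" using near_B assms by blast
  show ?thesis
  proof (cases "\<exists>u\<in>H. d w u \<le> 1 \<and> d c u \<ge> 2")
    case True
    then obtain u where u: "u \<in> H" "d w u \<le> 1" "d c u \<ge> 2" by blast
    obtain g where g: "gate c u g" using c u obtain_gate by blast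
    have "w \<in> towards c u" using towardsI c u assms B_H by simp
    then show ?thesis using that gateD(4,8)[OF g] by blast
  next
    case False
    then have "covers c w" using c assms B_H by (force simp: covers_def)
    then show ?thesis using that c by blast
  qed
qed

lemma obtain_fold:
  assumes "c \<in> B"
  obtains p where "\<And>w. w \<in> H \<Longrightarrow> p w \<in> B \<and> covers (p w) w" "\<And>w. w \<in> B \<Longrightarrow> p w = w"
proof -
  have "\<forall>w\<in>H. \<exists>z. z \<in> B \<and> covers z w" using obtain_covering[OF assms] by metis
  then obtain q where q: "\<And>w. w \<in> H \<Longrightarrow> q w \<in> B \<and> covers (q w) w" by metis
  show ?thesis
    by (rule that[of "\<lambda>w. if w \<in> B then w else q w"]) (use q B_H in \<open>auto simp: covers_def\<close>)
qed

text \<open>Folding maps adjacent \<open>u\<close>, \<open>z\<close> to equal or adjacent vertices: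
  \<open>p u\<close> covers \<open>u\<close> and so is near \<open>z\<close>, and \<open>p z\<close>
  covers \<open>z\<close> and so is near \<open>p u\<close>. Thus a folded geodesic is a walk in
  \<open>B\<close>. The last assumption ranges over all vertices on geodesics from \<open>u\<close>
  to \<open>v\<close>, so that it passes to the tail in the induction.\<close>

lemma folded_geodesic_avoiding:
  assumes p: "\<And>w. w \<in> H \<Longrightarrow> p w \<in> B \<and> covers (p w) w"
    and "u \<in> H" "v \<in> H"
    and "\<And>w. w \<in> H \<Longrightarrow> d u w + d w v = d u v \<Longrightarrow> \<not> twins c (p w)"
  shows "(avoiding c)\<^sup>*\<^sup>* (p u) (p v)"
  using assms(2,4)
proof (induction "d u v" arbitrary: u)
  case 0
  then have "u = v" using d_eq_0 H_V assms(3) by metis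
  then show ?case by simp
next
  case (Suc n)
  then have "u \<noteq> v" using H_V by auto
  then obtain z where z: "z \<in> H" "d u z = 1" "d u v = Suc (d z v)"
    using first_step Suc assms by blast
  have "\<not> twins c (p w)" if "w \<in> H" "d z w + d w v = d z v" for w
  proof (rule Suc)
    have "d u w \<le> 1 + d z w" "d u v \<le> d u w + d w v"
      using d_triangle_H[of u z w] d_triangle_H[of u w v] z Suc that assms by auto
    then show "d u w + d w v = d u v" using z that by simp
  qed (use that in simp)
  then have "(avoiding c)\<^sup>*\<^sup>* (p z) (p v)" using Suc z by simp
  moreover have "avoiding c (p u) (p z)"
  proof -
    have "d (p u) z \<le> 1" using p[of u] Suc z by (auto dest: coversD)
    then have "d z (p u) \<le> 1" using d_sym_H p[of u] Suc z B_H by simp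
    then have "d (p z) (p u) \<le> 1" using coversD(3)[of "p z" z "p u"] p z(1) Suc.prems(1) B_H by blast
    then have "d (p u) (p z) \<le> 1" using d_sym_H p[of u] p[of z] Suc z B_H by simp
    moreover have "\<not> twins c (p u)" using Suc H_V by simp
    moreover have "\<not> twins c (p z)" using Suc(4)[of z] z by simp
    ultimately show ?thesis using p z Suc by (simp add: avoiding_def)
  qed
  ultimately show ?case by (meson converse_rtranclp_into_rtranclp)
qed

section \<open>Gates from one vertex towards two targets\<close>

text \<open>A twin \<open>z\<close> nearer to \<open>x\<close> than \<open>c\<close> would be a
  first step towards \<open>x\<close>, hence covered by \<open>a\<close>. But \<open>b\<close> is
  adjacent to \<open>c\<close>, hence near its twin \<open>z\<close>, and so \<open>b\<close> would
  be near \<open>a\<close>.\<close>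

lemma twin_not_towards:
  assumes "gate c x a" "gate c y b" "d a b \<ge> 2" "twins c z" "z \<in> B"
  shows "d c x \<le> d z x"
proof (rule ccontr)
  assume "\<not> ?thesis"
  then have lt: "d z x < d c x" by simp
  note a = gateD[OF assms(1)] and b = gateD[OF assms(2)]
  have "d c z \<le> 1" using assms(4,5) a(1) B_V by (auto simp: twins_def)
  then have "z \<in> towards c x" using towardsI lt a assms B_H by simp
  then have "covers a z" using a by blast
  moreover have "d z b \<le> 1" using assms(4) b by (simp add: twins_def)
  ultimately have "d a b \<le> 1" using coversD b B_H by blast
  then show False using assms by simp
qed

text \<open>Otherwise geodesics from \<open>a\<close> to \<open>x\<close>, \<open>x\<close> to
  \<open>y\<close> and \<open>y\<close> to \<open>b\<close> are folded into a walk in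
  \<open>B\<close> from \<open>a\<close> to \<open>b\<close>. None of their vertices folds onto a
  twin of \<open>c\<close>, since it would be too far from \<open>x\<close> and \<open>y\<close>;
  this contradicts the separation at \<open>c\<close>.\<close>

lemma gates_adjacent:
  assumes "gate c x a" "gate c y b" and xy: "d x y < d c x + d c y"
  shows "d a b \<le> 1"
proof (rule ccontr)
  assume "\<not> ?thesis"
  then have ab: "d a b \<ge> 2" by simp
  note a = gateD[OF assms(1)] and b = gateD[OF assms(2)]
  have ba: "d b a \<ge> 2" using ab d_sym_H a b B_H by simp
  obtain p where p: "\<And>w. w \<in> H \<Longrightarrow> p w \<in> B \<and> covers (p w) w" and pB: "\<And>w. w \<in> B \<Longrightarrow> p w = w"
    using obtain_fold[OF a(1)] by blast
  note ntx = twin_not_towards[OF assms(1,2) ab] and nty = twin_not_towards[OF assms(2,1) ba]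
  \<comment> \<open>The bounds hold for \<open>p w\<close> and pass to \<open>w\<close> by covering.
    The targets differ from \<open>w\<close> because they are at distance at least 2 from
    \<open>p w\<close>, while \<open>w\<close> is within 1.\<close>
  have far: "d c x \<le> d w x \<and> d c y \<le> d w y" if w: "w \<in> H" "twins c (p w)" for w
  proof -
    have x: "d c x \<le> d (p w) x" and y: "d c y \<le> d (p w) y" using ntx nty w p by auto
    have "x \<noteq> w" using x a(3) p[OF w(1)] coversD(4) by fastforce
    moreover have "y \<noteq> w" using y b(3) p[OF w(1)] coversD(4) by fastforce
    ultimately show ?thesis using covers_closer p w a b x y by (meson le_trans)
  qed
  have "(avoiding c)\<^sup>*\<^sup>* (p a) (p x)"
  proof (rule folded_geodesic_avoiding[OF p])
    fix w assume "w \<in> H" "d a w + d w x = d a x"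
    then show "\<not> twins c (p w)" using far a(7) by fastforce
  qed (use a B_H in auto)
  moreover have "(avoiding c)\<^sup>*\<^sup>* (p x) (p y)"
  proof (rule folded_geodesic_avoiding[OF p])
    fix w assume "w \<in> H" "d x w + d w y = d x y"
    then show "\<not> twins c (p w)" using far xy d_sym_H a(2) by fastforce
  qed (use a b in auto)
  moreover have "(avoiding c)\<^sup>*\<^sup>* (p y) (p b)"
  proof (rule folded_geodesic_avoiding[OF p])
    fix w assume "w \<in> H" "d y w + d w b = d y b"
    then show "\<not> twins c (p w)" using far b d_sym_H B_H by fastforce
  qed (use b B_H in auto)
  ultimately have "(avoiding c)\<^sup>*\<^sup>* a b" using pB a(4) b(4) by simp
  then show False using not_avoiding ab a b by blast
qed

lemma gate_towards_other:
  assumes "gate c x a" "v \<in> towards c x" "v \<in> towards c y" "y \<in> H" "d c y \<ge> 2"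
  shows "a \<in> towards c y"
proof -
  note a = gateD[OF assms(1)] and v = towardsD[OF assms(3)]
  have "covers a v" using a assms by blast
  moreover have "y \<noteq> v" using v assms(5) by auto
  ultimately have "d a y \<le> d v y" using covers_closer assms by blast
  then show ?thesis using towardsI a v B_H assms by simp
qed

section \<open>Common first steps towards two targets\<close>

text \<open>If there is no common first step, \<open>a\<close> is no nearer to \<open>y\<close> than
  \<open>c\<close> is. The gates \<open>g\<close> and \<open>h\<close> from \<open>a\<close> towards
  \<open>x\<close> and \<open>y\<close> are then near each other. Here \<open>h\<close> covers
  \<open>b\<close>, so \<open>h\<close> is itself a first step from \<open>c\<close> towards
  \<open>y\<close>, and in turn \<open>b\<close> covers \<open>h\<close>. Hence \<open>b\<close> is
  near \<open>g\<close>, which is two steps nearer to \<open>x\<close> than \<open>c\<close>, so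
  \<open>b\<close> leads towards \<open>x\<close> as well.\<close>

lemma towards_meet_descent:
  assumes a: "gate c x a" and b: "gate c y b" and xy: "d x y + 2 \<le> d c x + d c y"
    and big: "d a x \<ge> 2"
  shows "towards c x \<inter> towards c y \<noteq> {}"
proof (rule ccontr)
  assume "\<not> ?thesis"
  then have disj: "\<And>v. v \<in> towards c x \<Longrightarrow> v \<in> towards c y \<Longrightarrow> False" by blast
  note A = gateD[OF a] and B = gateD[OF b]
  have ab: "d a b \<le> 1" using gates_adjacent[OF a b] xy by simp
  have ay: "d c y \<le> d a y" using disj[of a] towardsI[of c y a] A B B_H by fastforce
  have "d a y \<ge> 2" using ay B by simp
  obtain g where g: "gate a x g" using obtain_gate A big by blast
  obtain h where h: "gate a y h" using obtain_gate A(4) B(2) \<open>d a y \<ge> 2\<close> by blast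
  note G = gateD[OF g] and Hh = gateD[OF h]
  have gh: "d g h \<le> 1" using gates_adjacent[OF g h] xy ay A by simp
  have "b \<in> towards a y" using towardsI ab ay A B B_H by simp
  then have hb: "covers h b" using Hh by blast
  have "d b c \<le> 1" using B d_sym_H B_H by simp
  then have "d h c \<le> 1" using coversD(3)[OF hb] A(1) B_H by blast
  then have "d c h \<le> 1" using d_sym_H A Hh B_H by simp
  moreover have "d h y < d c y"
  proof -
    have "y \<noteq> b" using B H_V by auto
    then have "d h y \<le> d b y" using covers_closer hb B by blast
    then show ?thesis using B by simp
  qed
  ultimately have "h \<in> towards c y" using towardsI A B Hh B_H by simp
  then have "covers b h" using B by blast
  moreover have "d h g \<le> 1" using gh d_sym_H G Hh B_H by simp
  ultimately have "d b g \<le> 1" using coversD G B_H by blast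
  then have "d b x < d c x" using d_triangle_H[of b g x] G A B B_H by fastforce
  then have "b \<in> towards c x" using towardsI A B B_H by simp
  then show False using disj B by blast
qed

text \<open>The gate \<open>h\<close> from \<open>a\<close> towards \<open>y\<close> covers both
  \<open>x\<close> and \<open>b\<close>. Through \<open>x\<close> it is near \<open>x\<close> and
  \<open>y\<close>, through \<open>b\<close> it is near \<open>c\<close>, so it is a common first
  step after all.\<close>

lemma towards_meet_adjacent:
  assumes a: "gate c x a" and b: "gate c y b" and xy: "d x y \<le> 1" "d c x = 2" "d c y = 2"
  shows "towards c x \<inter> towards c y \<noteq> {}"
proof (rule ccontr)
  assume "\<not> ?thesis"
  then have disj: "\<And>v. v \<in> towards c x \<Longrightarrow> v \<in> towards c y \<Longrightarrow> False" by blast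
  note A = gateD[OF a] and B = gateD[OF b]
  have ab: "d a b \<le> 1" using gates_adjacent[OF a b] xy by simp
  have ay: "2 \<le> d a y" using disj[of a] towardsI[of c y a] A B B_H xy by fastforce
  obtain h where h: "gate a y h" using obtain_gate A(4) B(2) ay by blast
  note Hh = gateD[OF h]
  have "x \<in> towards a y" using towardsI[of a y x] ay A B B_H xy by simp
  then have hx: "covers h x" using Hh by blast
  have "b \<in> towards a y" using towardsI[of a y b] ab ay A B B_H xy by simp
  then have hb: "covers h b" using Hh by blast
  have "d b c \<le> 1" using B d_sym_H B_H by simp
  then have "d h c \<le> 1" using coversD(3)[OF hb] A(1) B_H by blast
  then have "d c h \<le> 1" using d_sym_H A Hh B_H by simp
  moreover have "d h x \<le> 1" using hx coversD by blast
  moreover have "d h y \<le> 1" using hx coversD xy B by blast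
  ultimately show False using disj[of h] towardsI[of c x h] towardsI[of c y h] xy A B Hh B_H by simp
qed

text \<open>If a gate leaves distance at least 2 to its target, the descent argument applies.
  Otherwise both targets are at distance 2 from \<open>c\<close>, and only the case of targets at
  distance 2 from each other remains; it is settled through their midpoint \<open>w\<close>,
  according to the distance from \<open>c\<close> to \<open>w\<close>.\<close>

lemma towards_meet:
  assumes c: "c \<in> B" and x: "x \<in> H" "d c x \<ge> 2" and y: "y \<in> H" "d c y \<ge> 2"
    and xy: "d x y + 2 \<le> d c x + d c y"
  shows "towards c x \<inter> towards c y \<noteq> {}"
proof -
  obtain a where a: "gate c x a" using c x obtain_gate by blast
  obtain b where b: "gate c y b" using c y obtain_gate by blast
  note A = gateD[OF a] and B = gateD[OF b]
  consider "d a x \<ge> 2" | "d b y \<ge> 2" | "d c x = 2" "d c y = 2" using A B by linarith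
  then show ?thesis
  proof cases
    case 1 then show ?thesis using towards_meet_descent[OF a b] xy by blast
  next
    case 2 then show ?thesis using towards_meet_descent[OF b a] xy d_sym_H x y by (simp add: Int_commute add.commute)
  next
    case 3
    show ?thesis
    proof (cases "d x y \<le> 1")
      case True then show ?thesis using towards_meet_adjacent[OF a b] 3 by blast
    next
      case False
      then have xy2: "d x y = 2" using xy 3 by simp
      then obtain w where w: "w \<in> H" "d x w = 1" "d w y = 1"
        using first_step[OF x(1) y(1)] x y H_V by fastforce
      have wx: "d w x = 1" and yw: "d y w = 1" using w x y d_sym_H by auto
      have "d c w \<le> 3" using d_triangle_H[of c x w] w x c 3 B_H by simp
      then consider "d c w \<le> 1" | "d c w = 2" | "d c w = 3" by linarith
      then show ?thesis
      proof cases
        case 1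
        then have "w \<in> towards c x \<inter> towards c y" using towardsI w wx 3 c x y B_H by simp
        then show ?thesis by blast
      next
        \<comment> \<open>A gate towards the midpoint shares a first step with each target, so it
          leads towards both.\<close>
        case 2
        then obtain g where g: "gate c w g" using obtain_gate[OF c w(1)] by auto
        obtain v where "v \<in> towards c w" "v \<in> towards c x"
          using towards_meet_adjacent[OF g a] wx 2 3 by auto
        then have "g \<in> towards c x" using gate_towards_other g x by blast
        moreover obtain v where "v \<in> towards c w" "v \<in> towards c y"
          using towards_meet_adjacent[OF g b] w 2 3 by auto
        then have "g \<in> towards c y" using gate_towards_other g y by blast
        ultimately show ?thesis by blast
      next
        \<comment> \<open>Both gates are first steps towards the midpoint, so the gate
          \<open>g\<close> towards it covers both and is near both targets.\<close>
        case 3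
        note 33 = \<open>d c x = 2\<close> \<open>d c y = 2\<close>
        obtain g where g: "gate c w g" using obtain_gate[OF c w(1)] 3 by auto
        note G = gateD[OF g]
        have "d a w \<le> 2" "d b w \<le> 2"
          using d_triangle_H[of a x w] d_triangle_H[of b y w] A B w yw x y B_H 33 by auto
        then have "a \<in> towards c w" "b \<in> towards c w"
          using towardsI[of c w] A B w B_H 3 by auto
        then have "covers g a" "covers g b" using G by blast+
        then have "d g x \<le> 1" "d g y \<le> 1" using coversD A B 33 x y by auto
        then have "g \<in> towards c x \<inter> towards c y" using towardsI[of c _ g] G 33 A x y B_H by simp
        then show ?thesis by blast
      qed
    qed
  qed
qed

lemma gate_decreases:
  assumes a: "gate c x a" and y: "y \<in> H" "d c y \<ge> 2" and xy: "d x y + 2 \<le> d c x + d c y"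
  shows "d c y = Suc (d a y)"
  using towards_meet[of c x y] gate_towards_other[OF a _ _ y] gateD[OF a] y xy
  by (auto dest: towardsD)

text \<open>If \<open>y\<close> is at distance at least 2 from \<open>c\<close>, the gate
  \<open>b\<close> towards it is near \<open>a\<close>, which gives the bound. The delicate case is
  a neighbour \<open>y\<close> of \<open>c\<close> not nearer to \<open>x\<close> than
  \<open>c\<close>: the next vertex \<open>u\<close> from \<open>y\<close> towards \<open>x\<close>
  either is covered by \<open>a\<close>, or has a gate that covers \<open>y\<close> and is itself
  covered by \<open>a\<close>.\<close>

lemma gate_no_increase:
  assumes a: "gate c x a" and y: "y \<in> H" and xy: "d x y < d c x + d c y"
  shows "d a y \<le> d c y"
proof -
  note A = gateD[OF a]
  consider "d c y = 0" | "d c y = 1" | "d c y \<ge> 2" by linarith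
  then show ?thesis
  proof cases
    case 1
    then have "c = y" using d_eq_0 A y B_V H_V by blast
    then show ?thesis using xy d_sym_H A B_H H_V by simp
  next
    case 2
    have yx: "d y x \<le> d c x" using xy 2 d_sym_H A y by simp
    show ?thesis
    proof (cases "d y x < d c x")
      case True
      then have "y \<in> towards c x" using towardsI A y 2 B_H by simp
      then show ?thesis using A coversD 2 by metis
    next
      case False
      with yx have yx: "d y x = d c x" by simp
      then have "y \<noteq> x" using A H_V by auto
      then obtain u where u: "u \<in> H" "d y u = 1" "d y x = Suc (d u x)"
        using first_step A y by blast
      have uy: "d u y = 1" using u d_sym_H y by simp
      show ?thesis
      proof (cases "d c u \<le> 1")
        case True
        then have "u \<in> towards c x" using towardsI A u yx B_H by simp
        then have "covers a u" using A by blast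
        then show ?thesis using coversD uy y 2 by simp
      next
        case False
        then have cu: "d c u \<ge> 2" by simp
        then obtain g where g: "gate c u g" using obtain_gate A u by blast
        note G = gateD[OF g]
        have "y \<in> towards c u" using towardsI[of c u y] A y u 2 cu B_H by simp
        then have gy: "covers g y" using G by blast
        have "d x u + 2 \<le> d c x + d c u" using u yx cu d_sym_H[of u x] A by simp
        then obtain v where "v \<in> towards c x" "v \<in> towards c u"
          using towards_meet[of c x u] A u cu by blast
        then have "g \<in> towards c x" using gate_towards_other[OF g] A by blast
        then have "covers a g" using A by blast
        then show ?thesis using gy coversD 2 d_sym_H y A by (metis H_V d_self zero_le)
      qed
    qed
  next
    case 3
    then obtain b where b: "gate c y b" using obtain_gate A y by blast
    have "d a b \<le> 1" using gates_adjacent[OF a b xy] .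
    then show ?thesis using d_triangle_H[of a b y] gateD[OF b] A B_H by fastforce
  qed
qed

section \<open>Straight walks in \<open>B\<close> are geodesics\<close>

text \<open>The gate from \<open>z\<close> towards \<open>y\<close> is adjacent to \<open>z\<close>,
  hence near its twin \<open>c\<close>. Restricting \<open>y\<close> to \<open>B\<close> settles the
  case where \<open>y\<close> is near \<open>z\<close>.\<close>

lemma twin_far:
  assumes "c \<in> B" "z \<in> B" "y \<in> B" "twins c z" "d c y \<ge> 2"
  shows "d c y \<le> d z y"
proof (cases "d z y \<le> 1")
  case True
  then show ?thesis using assms by (simp add: twins_def)
next
  case False
  then have "z \<noteq> y" "d z y \<ge> 2" using assms B_V by auto
  then obtain g where g: "gate z y g" using obtain_gate assms B_H by blast
  note G = gateD[OF g]
  have "d c g \<le> 1" using twinsD[OF assms(4) G(4)] G(6) by simp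
  then show ?thesis using d_triangle_H[of c g y] G assms B_H by simp
qed

text \<open>Let \<open>a\<close>, \<open>e\<close>, \<open>b\<close> be the last three vertices and
  \<open>o'\<close> the first. If \<open>b\<close> were not farther from \<open>o'\<close> than
  \<open>e\<close>, geodesics from \<open>a\<close> to \<open>o'\<close> and from \<open>o'\<close>
  to \<open>b\<close> would fold into a walk joining \<open>a\<close> and \<open>b\<close> without
  meeting a twin of \<open>e\<close>, contradicting the separation at \<open>e\<close>.\<close>

lemma locally_geodesic_imp_geodesic:
  assumes "\<And>i. i \<le> n \<Longrightarrow> c i \<in> B"
    and "\<And>i. Suc i \<le> n \<Longrightarrow> d (c i) (c (Suc i)) = 1"
    and "\<And>i. Suc (Suc i) \<le> n \<Longrightarrow> d (c i) (c (Suc (Suc i))) = 2"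
  shows "d (c 0) (c n) = n"
  using assms
proof (induction n)
  case 0
  then show ?case using B_V by simp
next
  case (Suc t)
  have ct: "d (c 0) (c t) = t" using Suc by simp
  consider "t = 0" | "t = 1" | "t \<ge> 2" by linarith
  then show ?case
  proof cases
    case 1
    then show ?thesis using Suc(3)[of 0] by simp
  next
    case 2
    then show ?thesis using Suc(4)[of 0] by (simp add: numeral_2_eq_2)
  next
    case 3
    then obtain m where m: "t = Suc m" by (metis Suc_n_not_le_n not0_implies_Suc le0 numeral_2_eq_2 le_trans)
    define a e b o' where "a = c m" and "e = c t" and "b = c (Suc t)" and "o' = c 0"
    have inB: "a \<in> B" "e \<in> B" "b \<in> B" "o' \<in> B"
      using Suc(2) m by (auto simp: a_def e_def b_def o'_def)
    have ae: "d a e = 1" and eb: "d e b = 1" and ab: "d a b = 2"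
      using Suc(3)[of m] Suc(3)[of t] Suc(4)[of m] m by (auto simp: a_def e_def b_def)
    have ea: "d e a = 1" and ba: "d b a = 2" using ae ab d_sym_H inB B_H by auto
    have eo: "d e o' = t" using ct d_sym_H inB B_H by (simp add: e_def o'_def)
    have le: "d o' b \<le> Suc t" using d_triangle_H[of o' e b] eb eo d_sym_H inB B_H by simp
    have ao: "d a o' \<le> m"
    proof -
      have "d (c 0) (c k) \<le> k" if "k \<le> t" for k
        using that
      proof (induction k)
        case 0
        then show ?case using Suc(2) B_V by simp
      next
        case (Suc k)
        then show ?case using d_triangle_H[of "c 0" "c k" "c (Suc k)"] Suc.prems
            \<open>\<And>i. Suc i \<le> Suc t \<Longrightarrow> d (c i) (c (Suc i)) = 1\<close>[of k]
            \<open>\<And>i. i \<le> Suc t \<Longrightarrow> c i \<in> B\<close> B_H by fastforce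
      qed
      from this[of m] have "d (c 0) (c m) \<le> m" using m by simp
      then show ?thesis using d_sym_H inB B_H by (simp add: a_def o'_def)
    qed
    show ?thesis
    proof (rule ccontr)
      assume "\<not> ?thesis"
      then have ob: "d o' b \<le> t" using le by (simp add: o'_def b_def)
      obtain p where p: "\<And>w. w \<in> H \<Longrightarrow> p w \<in> B \<and> covers (p w) w" and pB: "\<And>w. w \<in> B \<Longrightarrow> p w = w"
        using obtain_fold inB(1) by blast
      \<comment> \<open>Twins of \<open>e\<close> in \<open>B\<close> are as far from
        \<open>o'\<close> as \<open>e\<close>, and covering transfers this to \<open>w\<close>; for
        \<open>w = o'\<close> it would put \<open>o'\<close> near \<open>e\<close>, although
        \<open>t\<close> is at least 2.\<close>
      have far: "t \<le> d w o'" if w: "w \<in> H" "twins e (p w)" for w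
      proof (cases "w = o'")
        case True
        then have "d e o' \<le> 1" using twinsD[OF w(2) inB(4)] pB inB B_V by simp
        then show ?thesis using eo 3 by simp
      next
        case False
        then have "d (p w) o' \<le> d w o'" using covers_closer p w inB B_H by blast
        moreover have "d e o' \<le> d (p w) o'" using twin_far[OF inB(2) _ inB(4) w(2)] p[OF w(1)] eo 3 by simp
        ultimately show ?thesis using eo by simp
      qed
      have "(avoiding e)\<^sup>*\<^sup>* (p a) (p o')"
      proof (rule folded_geodesic_avoiding[OF p])
        fix w assume "w \<in> H" "d a w + d w o' = d a o'"
        then show "\<not> twins e (p w)" using far[of w] ao m by auto
      qed (use inB B_H in auto)
      moreover have "(avoiding e)\<^sup>*\<^sup>* (p o') (p b)"
      proof (rule folded_geodesic_avoiding[OF p])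
        fix w assume w: "w \<in> H" "d o' w + d w b = d o' b"
        show "\<not> twins e (p w)"
        proof
          assume tw: "twins e (p w)"
          then have "t \<le> d o' w" using far[of w] w d_sym_H inB B_H by simp
          \<comment> \<open>Only the end \<open>b\<close> can be this far from \<open>o'\<close>,
            and \<open>b\<close> is no twin of \<open>e\<close>, since \<open>a\<close> is adjacent
            to \<open>e\<close> but not to \<open>b\<close>.\<close>
          then have "d w b = 0" using w ob by linarith
          then have "w = b" using d_eq_0 w inB H_V B_V by blast
          then have "d b a \<le> 1" using tw pB inB ea by (simp add: twins_def)
          then show False using ba by simp
        qed
      qed (use inB B_H in auto)
      ultimately have "(avoiding e)\<^sup>*\<^sup>* a b" using pB inB by simp
      then show False using not_avoiding[OF inB(2,1,3) ea eb] ab by simp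
    qed
  qed
qed

text \<open>The excess of a cop at \<open>c\<close> over a robber at \<open>r\<close> is the maximum of \<open>d c x - d r x\<close> over all
  \<open>x \<in> H\<close>, truncated at \<open>0\<close>.\<close>

definition excess :: "'a \<Rightarrow> 'a \<Rightarrow> nat" where
  "excess c r = (LEAST M. \<forall>x\<in>H. d c x \<le> d r x + M)"

lemma excess_le_iff:
  assumes "c \<in> V" "r \<in> V"
  shows "excess c r \<le> M \<longleftrightarrow> (\<forall>x\<in>H. d c x \<le> d r x + M)"
proof -
  \<comment> \<open>The value \<open>d c r\<close> satisfies the defining condition, so the least
    such number exists.\<close>
  have "\<forall>x\<in>H. d c x \<le> d r x + d c r" using d_triangle[of c r] assms H_V by (simp add: add.commute)
  then have *: "\<forall>x\<in>H. d c x \<le> d r x + excess c r" unfolding excess_def by (rule LeastI)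
  show ?thesis
  proof
    assume "excess c r \<le> M"
    then show "\<forall>x\<in>H. d c x \<le> d r x + M" using * by (meson add_left_mono le_trans)
  next
    assume "\<forall>x\<in>H. d c x \<le> d r x + M"
    then show "excess c r \<le> M" unfolding excess_def by (rule Least_le)
  qed
qed

lemma excess_bound:
  assumes "c \<in> V" "r \<in> V" "x \<in> H"
  shows "d c x \<le> d r x + excess c r"
  using excess_le_iff[OF assms(1,2)] assms(3) by blast

lemma excess_attained:
  assumes "c \<in> V" "r \<in> V" "excess c r \<ge> 1"
  shows "\<exists>x\<in>H. d c x = d r x + excess c r"
proof -
  have "\<not> excess c r \<le> excess c r - 1" using assms by simp
  then obtain x where "x \<in> H" "\<not> d c x \<le> d r x + (excess c r - 1)"
    using excess_le_iff assms by blast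
  then show ?thesis using excess_bound[OF assms(1,2), of x] assms(3) by (intro bexI[of _ x]) auto
qed

section \<open>The pursuing move and its effect on the excess\<close>

definition pursuit :: "'a \<Rightarrow> 'a \<Rightarrow> 'a \<Rightarrow> bool" where
  "pursuit c r g \<longleftrightarrow> c \<in> B \<and> r \<in> V \<and> d c r \<ge> 2 \<and> 
     (if excess c r = 0 then g = c else (\<exists>x. d c x = d r x + excess c r \<and> gate c x g))"

lemma ex_pursuit:
  assumes "c \<in> B" "r \<in> V" "d c r \<ge> 2"
  shows "\<exists>g. pursuit c r g"
proof (cases "excess c r = 0")
  case False
  then obtain x where x: "x \<in> H" "d c x = d r x + excess c r"
    using excess_attained assms B_V by (metis One_nat_def Suc_leI neq0_conv)
  \<comment> \<open>A gate needs a target at distance at least 2. The target cannot be the robber's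
    vertex if it is nearer than that, so \<open>d r x\<close> and the excess each contribute at
    least 1.\<close>
  have "d r x \<noteq> 0" if "d c x < 2"
    using that d_eq_0[of r x] assms(2,3) x(1) H_V by auto
  then have "d c x \<ge> 2" using x False by linarith
  then show ?thesis using obtain_gate[OF assms(1) x(1)] x False assms unfolding pursuit_def by metis
qed (use assms in \<open>simp add: pursuit_def\<close>)

lemma pursuit_step:
  assumes "pursuit c r g"
  shows "g \<in> B" "d c g \<le> 1"
  using assms gateD B_V by (auto simp: pursuit_def split: if_splits)

lemma pursuitD:
  assumes "pursuit c r g"
  shows "c \<in> B" "r \<in> V" "d c r \<ge> 2" "g \<in> B"
  using assms pursuit_step[OF assms] by (simp_all add: pursuit_def)

text \<open>The required gain depends on how tight the excess bound is at \<open>y\<close>: with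
  slack at least 2 any step will do, with slack 1 the distance must not grow, and with slack 0 it
  must shrink. The inequality \<open>xy\<close> supplies just what the statements about gates
  require in each case.\<close>

lemma pursuit_reduces:
  assumes "pursuit c r g" "excess c r \<ge> 1" "y \<in> H"
  shows "Suc (d g y) \<le> d r y + excess c r"
proof -
  let ?M = "excess c r"
  have P: "c \<in> B" "r \<in> V" "d c r \<ge> 2" using assms by (auto simp: pursuit_def)
  obtain x where x: "d c x = d r x + ?M" and g: "gate c x g"
    using assms by (auto simp: pursuit_def)
  note G = gateD[OF g]
  have "d x y \<le> d r x + d r y"
    using d_triangle[of x r y] d_sym[of x r] P G assms H_V by simp
  then have xy: "d x y + ?M \<le> d c x + d r y" using x by simp
  have bound: "d c y \<le> d r y + ?M" using excess_bound P assms B_V by blast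
  consider "d c y + 2 \<le> d r y + ?M" | "d c y + 1 = d r y + ?M" | "d c y = d r y + ?M"
    using bound by linarith
  then show ?thesis
  proof cases
    case 1
    have "d c g = 1" by (rule G)
    have "d g y \<le> d g c + d c y" using d_triangle_H G assms B_H by blast
    then show ?thesis using 1 d_sym_H[of g c] G B_H by simp
  next
    case 2
    then have "d g y \<le> d c y" using gate_no_increase[OF g assms(3)] xy assms by simp
    then show ?thesis using 2 by simp
  next
    case 3
    have "d c y \<ge> 2"
    proof (rule ccontr)
      assume "\<not> ?thesis"
      then have "d r y = 0" "d c y \<le> 1" using 3 assms by auto
      then show False using d_eq_0[of r y] P assms H_V by auto
    qed
    then have "d c y = Suc (d g y)" using gate_decreases[OF g assms(3)] xy 3 assms by simp
    then show ?thesis using 3 by simp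
  qed
qed

text \<open>The robber's step restores at most the 1 that the cop has gained. The
  \<open>max 1\<close> accounts for excess 0, where the cop waits and the robber may gain 1.\<close>

lemma excess_after_pursuit:
  assumes "pursuit c r g" "r' \<in> V" "d r r' \<le> 1"
  shows "excess g r' \<le> max 1 (excess c r)"
proof -
  note P = pursuitD[OF assms(1)]
  have "d g y \<le> d r' y + max 1 (excess c r)" if y: "y \<in> H" for y
  proof -
    have *: "d r y \<le> 1 + d r' y" using d_triangle[of r r' y] assms P H_V y by fastforce
    show ?thesis
    proof (cases "excess c r = 0")
      case True
      then have "g = c" using assms by (simp add: pursuit_def)
      then show ?thesis using excess_bound[of c r y] True P B_V y * by simp
    next
      case False
      then show ?thesis using pursuit_reduces[OF assms(1) _ y] * by simp
    qed
  qed
  then show ?thesis using excess_le_iff P assms B_V by blast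
qed

text \<open>An unchanged excess forces the robber to have stepped straight towards the second target
  \<open>y\<close>. The first move then also shortened the distance to \<open>y\<close>, so two
  moves shorten it by 2 and cannot end nearer than 2 from \<open>c\<close>.\<close>

lemma pursuit_straight:
  assumes p: "pursuit c r g" and q: "pursuit g r' g'" and r: "d r r' \<le> 1"
    and eq: "excess g r' = excess c r" and ge: "excess c r \<ge> 2"
  shows "d c g' = 2"
proof -
  let ?M = "excess c r"
  note P = pursuitD[OF p] pursuitD[OF q]
  obtain x where x: "d c x = d r x + ?M" and g: "gate c x g"
    using p ge by (auto simp: pursuit_def)
  obtain y where y: "d g y = d r' y + ?M" and g': "gate g y g'"
    using q ge eq by (auto simp: pursuit_def)
  note G = gateD[OF g] and G' = gateD[OF g']
  have "Suc (d g y) \<le> d r y + ?M" using pursuit_reduces[OF p _ G'(2)] ge by simp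
  moreover have "d r y \<le> 1 + d r' y" using d_triangle[of r r' y] r P G' H_V by fastforce
  ultimately have ry: "d r y = Suc (d r' y)" using y by simp
  have "d x y \<le> d r x + d r y"
    using d_triangle[of x r y] d_sym[of x r] P G G' H_V by simp
  then have xy': "d x y + ?M + ?M \<le> d c x + d g y + 1" using x y ry by simp
  have "d g y \<le> 1 + d c y" using d_triangle_H[of g c y] d_sym_H[of g c] G G' B_H by simp
  \<comment> \<open>Replacing \<open>d g y\<close> by \<open>1 + d c y\<close> costs 1 more, so
    twice the excess must exceed 2 by at least 2: this is where excess at least 2 enters.\<close>
  then have xy: "d x y + 2 \<le> d c x + d c y" using xy' ge by simp
  have "d c y = Suc (d g y)"
  proof (cases "d c y \<ge> 2")
    case True
    then show ?thesis using gate_decreases[OF g G'(2) _ xy] by blast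
  next
    case False
    then have "d g y \<le> d c y" using gate_no_increase[OF g G'(2)] xy by simp
    then show ?thesis using False G'(3) by simp
  qed
  then have "d c y = Suc (Suc (d g' y))" using G' by simp
  moreover have "d c y \<le> d c g' + d g' y" using d_triangle_H P G' B_H by blast
  moreover have "d c g' \<le> 2" using d_triangle_H[of c g g'] P G G' B_H by simp
  ultimately show ?thesis by simp
qed

section \<open>The strategy and the number of rounds it needs\<close>

text \<open>A capture may carry the cop out of \<open>B\<close>; from then on the default branch
  keeps it in place, which makes every move legal.\<close>

definition cop_step :: "'a \<Rightarrow> 'a \<Rightarrow> 'a" where
  "cop_step c r = (if c \<in> B \<and> r \<in> V then if d c r \<le> 1 then r else SOME g. pursuit c r g else c)"

lemma pursuit_cop_step:
  assumes "c \<in> B" "r \<in> V" "d c r \<ge> 2"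
  shows "pursuit c r (cop_step c r)"
  using someI_ex[OF ex_pursuit[OF assms]] assms by (simp add: cop_step_def)

lemma cop_step_legal:
  assumes "c \<in> V"
  shows "cop_step c r \<in> V" "d c (cop_step c r) \<le> 1"
proof -
  have "cop_step c r \<in> V \<and> d c (cop_step c r) \<le> 1"
  proof (cases "c \<in> B \<and> r \<in> V \<and> d c r \<ge> 2")
    case True
    then show ?thesis using pursuit_cop_step pursuit_step B_V by blast
  qed (use assms in \<open>auto simp: cop_step_def\<close>)
  then show "cop_step c r \<in> V" "d c (cop_step c r) \<le> 1" by auto
qed

text \<open>If the excess stayed constant and at least 2 for \<open>D\<close> moves, the cop's path
  would be straight throughout, hence a geodesic of length \<open>D\<close>, which exceeds every
  distance in \<open>V\<close>.\<close>

lemma excess_decreases: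
  assumes D: "\<And>x y. x \<in> V \<Longrightarrow> y \<in> V \<Longrightarrow> d x y < D"
    and p: "\<And>s. s < D \<Longrightarrow> pursuit (c s) (r s) (c (Suc s))"
    and r: "\<And>s. r s \<in> V" "\<And>s. d (r s) (r (Suc s)) \<le> 1"
    and ge: "max 1 (excess (c 0) (r 0)) \<ge> 2"
  shows "max 1 (excess (c D) (r D)) < max 1 (excess (c 0) (r 0))"
proof (rule ccontr)
  assume stuck: "\<not> ?thesis"
  define f where "f s = max 1 (excess (c s) (r s))" for s
  have step: "f (Suc s) \<le> f s" if "s < D" for s
    using excess_after_pursuit[OF p[OF that] r(1) r(2)] by (simp add: f_def)
  have const: "f s = f 0" if "s \<le> D" for s
  proof -
    have "f 0 \<le> f D" using stuck by (simp only: f_def not_less)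
    then show ?thesis
      using nonincreasing_upto[of D f 0 s] nonincreasing_upto[of D f s D] step that by simp
  qed
  have e: "excess (c s) (r s) = excess (c 0) (r 0)" if "s \<le> D" for s
    using const[OF that] ge by (simp add: f_def max_def split: if_splits)
  have e2: "excess (c s) (r s) \<ge> 2" if "s \<le> D" for s
    using e[OF that] ge by (simp add: max_def split: if_splits)
  have cB: "c s \<in> B" if "s \<le> D" for s
  proof (cases s)
    case 0
    have "D > 0" using D[OF r(1) r(1)] by (metis gr0I not_less_zero)
    then show ?thesis using p[of 0] 0 by (simp add: pursuit_def)
  next
    case (Suc k)
    then show ?thesis using pursuit_step p[of k] that by simp
  qed
  have "d (c 0) (c D) = D"
  proof (rule locally_geodesic_imp_geodesic)
    fix i assume "Suc i \<le> D"
    then have "pursuit (c i) (r i) (c (Suc i))" "excess (c i) (r i) \<ge> 2" using p e2 by auto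
    then show "d (c i) (c (Suc i)) = 1" using gateD(6) by (auto simp: pursuit_def)
  next
    fix i assume "Suc (Suc i) \<le> D"
    then show "d (c i) (c (Suc (Suc i))) = 2"
      using pursuit_straight[OF p[of i] p[of "Suc i"] r(2)] e[of i] e[of "Suc i"] e2[of i] by simp
  qed (use cB in blast)
  then show False using D[of "c 0" "c D"] cB B_V by simp
qed

lemma cop_step_guards:
  obtains N where "\<And>c r t. c 0 \<in> B \<Longrightarrow> (\<And>s. c (Suc s) = cop_step (c s) (r s)) \<Longrightarrow>
      (\<And>s. r s \<in> V) \<Longrightarrow> (\<And>s. d (r s) (r (Suc s)) \<le> 1) \<Longrightarrow> t \<ge> N \<Longrightarrow>
      (\<And>s. s < t \<Longrightarrow> c (Suc s) \<noteq> r s) \<Longrightarrow>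
      c t \<in> B \<and> (r t \<in> H \<longrightarrow> c (Suc t) = r t)"
proof -
  define D where "D = Suc (Max ((\<lambda>(x, y). d x y) ` (V \<times> V)))"
  have D: "d x y < D" if "x \<in> V" "y \<in> V" for x y
  proof -
    have "d x y \<in> (\<lambda>(x, y). d x y) ` (V \<times> V)" using that by force
    then show ?thesis unfolding D_def using finite_V by (simp add: le_imp_less_Suc)
  qed
  have "c t \<in> B \<and> (r t \<in> H \<longrightarrow> c (Suc t) = r t)"
    if c0: "c 0 \<in> B" and c: "\<And>s. c (Suc s) = cop_step (c s) (r s)"
      and r: "\<And>s. r s \<in> V" "\<And>s. d (r s) (r (Suc s)) \<le> 1" and t: "t \<ge> D * D"
      and free: "\<And>s. s < t \<Longrightarrow> c (Suc s) \<noteq> r s" for c r t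
  proof -
    \<comment> \<open>Within distance 1 the cop would have moved onto the robber.\<close>
    have far: "d (c s) (r s) \<ge> 2" if "c s \<in> B" "s < t" for s
      using free[OF that(2)] c[of s] that(1) r(1)[of s] by (cases "d (c s) (r s) \<le> 1") (auto simp: cop_step_def)
    have cB: "c s \<in> B" if "s \<le> t" for s
      using that
    proof (induction s)
      case (Suc s)
      then show ?case using pursuit_step(1)[OF pursuit_cop_step] far[of s] r c by simp
    qed (use c0 in simp)
    have p: "pursuit (c s) (r s) (c (Suc s))" if "s < t" for s
      using pursuit_cop_step[of "c s" "r s"] far cB[of s] r c that by simp
    define f where "f s = max 1 (excess (c s) (r s))" for s
    have step: "f (Suc s) \<le> f s" if "s < t" for s
      using excess_after_pursuit[OF p[OF that] r(1) r(2)] by (simp add: f_def)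
    have f_ge: "f s \<ge> 1" for s by (simp add: f_def)
    \<comment> \<open>Each stretch of \<open>D\<close> rounds lowers the truncated excess by at
      least 1 until it is 1. As it starts at no more than \<open>D\<close>, \<open>D * D\<close>
      rounds suffice.\<close>
    have "f (k * D) \<le> max 1 (f 0 - k)" if "k * D \<le> t" for k
      using that
    proof (induction k)
      case (Suc k)
      show ?case
      proof (cases "f (k * D) \<ge> 2")
        case True
        have "f (k * D + D) < f (k * D)"
          using excess_decreases[OF D, of "\<lambda>s. c (k * D + s)" "\<lambda>s. r (k * D + s)"] p r True Suc.prems
          by (simp add: f_def add.commute)
        then show ?thesis using Suc by (simp add: add.commute)
      next
        case False
        then show ?thesis using nonincreasing_upto[of t f "k * D" "Suc k * D"] step Suc.prems by simp
      qed
    qed (simp add: f_def)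
    from this[of D] have "f (D * D) \<le> max 1 (f 0 - D)" using t by simp
    moreover have "f 0 \<le> D"
    proof -
      have "d (c 0) x \<le> d (r 0) x + d (c 0) (r 0)" if "x \<in> H" for x
        using d_triangle[of "c 0" "r 0" x] c0 r(1)[of 0] B_V H_V that by simp
      then have "excess (c 0) (r 0) \<le> d (c 0) (r 0)"
        using excess_le_iff[of "c 0" "r 0"] c0 r(1)[of 0] B_V by blast
      then show ?thesis using D[of "c 0" "r 0"] c0 r(1)[of 0] B_V by (simp add: f_def)
    qed
    ultimately have "f (D * D) \<le> 1" by simp
    moreover have "f t \<le> f (D * D)" using nonincreasing_upto[of t f] step t by simp
    ultimately have e: "excess (c t) (r t) \<le> 1" by (simp add: f_def)
    have "c (Suc t) = r t" if "r t \<in> H"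
    proof -
      \<comment> \<open>The excess bound is taken at the robber's own vertex, where
        \<open>d r x\<close> vanishes.\<close>
      have "d (c t) (r t) \<le> 1"
        using excess_bound[of "c t" "r t" "r t"] e cB[of t] B_V r that by fastforce
      then show ?thesis using c cB[of t] r by (simp add: cop_step_def)
    qed
    then show ?thesis using cB[of t] by simp
  qed
  then show ?thesis using that by blast
qed

end

section \<open>Block graphs\<close>

text \<open>In a walk of least length no vertex repeats, since the part between two visits could be
  cut out.\<close>

lemma rtranclp_injective_path:
  assumes "P\<^sup>*\<^sup>* x y"
  obtains f and n :: nat where "f 0 = x" "f n = y" "\<And>i. i < n \<Longrightarrow> P (f i) (f (Suc i))" "inj_on f {..n}"
proof -
  define n where "n = (LEAST n. (P ^^ n) x y)"
  have ex: "\<exists>n. (P ^^ n) x y" using assms by (simp add: rtranclp_power)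
  have "(P ^^ n) x y" unfolding n_def using ex by (rule LeastI_ex)
  then obtain f where f: "f 0 = x" "f n = y" "\<And>i. i < n \<Longrightarrow> P (f i) (f (Suc i))"
    by (auto simp: relpowp_fun_conv)
  have seg: "(P ^^ (b - a)) (f a) (f b)" if "a \<le> b" "b \<le> n" for a b
    unfolding relpowp_fun_conv using that f(3) by (intro exI[of _ "\<lambda>k. f (a + k)"]) auto
  have "f i \<noteq> f j" if "i < j" "j \<le> n" for i j
  proof
    assume "f i = f j"
    then have "(P ^^ (i + (n - j))) x y"
      using relpowp_trans[of i P x "f i" "n - j" y] seg[of 0 i] seg[of j n] that f(1,2) by simp
    then have "n \<le> i + (n - j)" unfolding n_def by (rule Least_le)
    then show False using that by simp
  qed
  then have "inj_on f {..n}" by (intro linorder_inj_onI) auto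
  then show ?thesis using that f by blast
qed

context graph
begin

lemma del_vert_induce_subgraph: "pre_digraph.del_vert (G \<restriction> S) v = G \<restriction> (S - {v})"
  by (auto simp: pre_digraph.del_vert_def induce_subgraph_def)

lemma dominates_induce_subgraph_iff: "u \<rightarrow>\<^bsub>G \<restriction> S\<^esub> v \<longleftrightarrow> u \<rightarrow> v \<and> u \<in> S \<and> v \<in> S"
  by (auto simp: arcs_ends_conv)

lemma graph_induce_subgraph: "S \<subseteq> verts G \<Longrightarrow> graph (G \<restriction> S)"
  by (simp add: graph_def pseudo_graph_def digraphI_induced induced_graph_imp_graph induced_induce
      digraph.axioms(1))

lemma reachable_along:
  assumes "a \<le> b" "\<And>i. a \<le> i \<Longrightarrow> i \<le> b \<Longrightarrow> f i \<in> S" "\<And>i. a \<le> i \<Longrightarrow> i < b \<Longrightarrow> f i \<rightarrow> f (Suc i)"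
  shows "f a \<rightarrow>\<^sup>*\<^bsub>G \<restriction> S\<^esub> f b"
  using assms
proof (induction b rule: dec_induct)
  case base
  then show ?case using wf_digraph.reachable_refl[OF wellformed_induce_subgraph] by simp
next
  case (step n)
  then have "f n \<rightarrow>\<^bsub>G \<restriction> S\<^esub> f (Suc n)" by (simp add: dominates_induce_subgraph_iff)
  then show ?case using wf_digraph.reachable_adj_trans[OF wellformed_induce_subgraph] step by simp
qed

lemma reachable_via:
  assumes "S \<subseteq> verts G" "\<And>u. u \<in> S \<Longrightarrow> u \<rightarrow>\<^sup>*\<^bsub>G \<restriction> S\<^esub> h" "u \<in> S" "v \<in> S"
  shows "u \<rightarrow>\<^sup>*\<^bsub>G \<restriction> S\<^esub> v"
proof -
  have "symmetric (G \<restriction> S)"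
    using induced_graph_imp_symmetric[OF sym_arcs induced_induce[OF assms(1)]] .
  then have "h \<rightarrow>\<^sup>*\<^bsub>G \<restriction> S\<^esub> v" using symmetric_reachable assms by metis
  then show ?thesis using wf_digraph.reachable_trans[OF wellformed_induce_subgraph] assms by metis
qed

text \<open>The path and \<open>z\<close> form a cycle, or an edge if \<open>n = 0\<close>. Without
  \<open>z\<close> the path remains; without \<open>f j\<close> each of the two remaining pieces is
  still joined to \<open>z\<close> through \<open>f 0\<close> or \<open>f n\<close>.\<close>

lemma two_connected_cycle:
  assumes z: "z \<rightarrow> f 0" "z \<rightarrow> f n"
    and f: "\<And>i. i < n \<Longrightarrow> f i \<rightarrow> f (Suc i)" "inj_on f {..n}" "\<And>i. i \<le> n \<Longrightarrow> f i \<noteq> z"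
  shows "two_connected (G \<restriction> insert z (f ` {..n}))"
proof -
  let ?W = "insert z (f ` {..n})"
  have fV: "f i \<in> verts G" if "i \<le> n" for i
  proof (cases i)
    case (Suc k)
    then show ?thesis using f(1)[of k] that adj_in_verts by simp
  qed (use z(1) adj_in_verts in simp)
  then have W: "?W \<subseteq> verts G" using z by (auto dest: adj_in_verts)
  note wf = wellformed_induce_subgraph
  have to_z: "f i \<rightarrow> z" if "i = 0 \<or> i = n" for i
    using z graph_symmetric that by auto
  have down: "f i \<rightarrow>\<^sup>*\<^bsub>G \<restriction> S\<^esub> f 0" if "i \<le> n" "S \<subseteq> verts G" "\<And>k. k \<le> i \<Longrightarrow> f k \<in> S" for i S
  proof -
    have "f 0 \<rightarrow>\<^sup>*\<^bsub>G \<restriction> S\<^esub> f i" using reachable_along[of 0 i f S] that f by simp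
    then show ?thesis
      using symmetric_reachable induced_graph_imp_symmetric[OF sym_arcs induced_induce] that by metis
  qed
  have conn: "u \<rightarrow>\<^sup>*\<^bsub>G \<restriction> ?W\<^esub> v" if "u \<in> ?W" "v \<in> ?W" for u v
  proof (rule reachable_via[OF W _ that])
    fix u assume "u \<in> ?W"
    moreover have "z \<rightarrow>\<^sup>*\<^bsub>G \<restriction> ?W\<^esub> f 0"
      using wf_digraph.reachable_adjI[OF wf] z by (simp add: dominates_induce_subgraph_iff)
    ultimately show "u \<rightarrow>\<^sup>*\<^bsub>G \<restriction> ?W\<^esub> f 0" using down[OF _ W] by auto
  qed
  have nocut: "u \<rightarrow>\<^sup>*\<^bsub>G \<restriction> (?W - {c})\<^esub> v" if c: "c \<in> ?W" and uv: "u \<in> ?W - {c}" "v \<in> ?W - {c}" for c u v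
  proof (cases "c = z")
    case True
    show ?thesis
    proof (rule reachable_via[OF _ _ uv])
      fix u assume "u \<in> ?W - {c}"
      then show "u \<rightarrow>\<^sup>*\<^bsub>G \<restriction> (?W - {c})\<^esub> f 0" using down[of _ "?W - {c}"] W f(3) True by auto
    qed (use W in auto)
  next
    case False
    then obtain j where j: "j \<le> n" "c = f j" using c by auto
    have inS: "f k \<in> ?W - {c}" if "k \<le> n" "k \<noteq> j" for k
      using that j f(2) by (auto simp: inj_on_eq_iff)
    show ?thesis
    proof (rule reachable_via[OF _ _ uv])
      fix u assume u: "u \<in> ?W - {c}"
      have zS: "z \<in> ?W - {c}" using False by simp
      show "u \<rightarrow>\<^sup>*\<^bsub>G \<restriction> (?W - {c})\<^esub> z"
      proof (cases "u = z")
        case True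
        then show ?thesis using wf_digraph.reachable_refl[OF wf] zS by simp
      next
        case False
        then obtain i where i: "i \<le> n" "u = f i" "i \<noteq> j" using u j by auto
        show ?thesis
        proof (cases "i < j")
          case True
          have "f i \<rightarrow>\<^sup>*\<^bsub>G \<restriction> (?W - {c})\<^esub> f 0" using down[OF i(1), of "?W - {c}"] W True inS j by fastforce
          moreover have "f 0 \<rightarrow>\<^bsub>G \<restriction> (?W - {c})\<^esub> z"
            using to_z zS inS[of 0] True by (simp add: dominates_induce_subgraph_iff)
          ultimately show ?thesis using wf_digraph.reachable_adj_trans[OF wf] i by metis
        next
          case False
          have "f i \<rightarrow>\<^sup>*\<^bsub>G \<restriction> (?W - {c})\<^esub> f n"
            by (rule reachable_along) (use i False inS f in auto)
          moreover have "f n \<rightarrow>\<^bsub>G \<restriction> (?W - {c})\<^esub> z"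
            using to_z zS inS[of n] False i by (simp add: dominates_induce_subgraph_iff)
          ultimately show ?thesis using wf_digraph.reachable_adj_trans[OF wf] i by metis
        qed
      qed
    qed (use W in auto)
  qed
  have "connected (G \<restriction> ?W)"
    unfolding connected_def strongly_connected_def
    using conn wf_digraph.reachable_mk_symmetricI[OF wf] by (auto simp del: insert_iff)
  then show ?thesis
    using graph_induce_subgraph[OF W] nocut
    by (simp add: two_connected_def cut_vertex_def del_vert_induce_subgraph del: insert_iff)
qed

text \<open>Among the two-connected subgraphs containing \<open>C\<close> one is chosen with the
  largest number of vertices and arcs. Both are counted because subgraphs need not be
  induced.\<close>

lemma two_connected_in_block:
  assumes "two_connected C" "subgraph C G"
  shows "\<exists>D. block_of D G \<and> subgraph C D"
proof -
  define P where "P D \<longleftrightarrow> two_connected D \<and> subgraph C D \<and> subgraph D G" for D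
  define m where "m D = card (verts D) + card (arcs D)" for D :: "('a, 'b) pre_digraph"
  have "P C" using assms by (auto simp: P_def intro: wf_digraph.subgraph_refl)
  moreover have "\<forall>D. P D \<longrightarrow> m D < Suc (m G)"
    unfolding P_def m_def subgraph_def less_Suc_eq_le by (auto intro!: add_mono card_mono)
  ultimately obtain D where D: "P D" "\<And>D'. P D' \<Longrightarrow> m D' \<le> m D"
    using Lattices_Big.ex_has_greatest_nat[of P C m "Suc (m G)"] by blast
  have "D' = D" if D': "subgraph D D'" "subgraph D' G" "two_connected D'" for D'
  proof -
    have "P D'" using D D' subgraph_trans by (auto simp: P_def)
    then have "m D' \<le> m D" using D by blast
    interpret D': fin_digraph D'
      using D'(3) by (simp add: two_connected_def graph_def digraph_def)
    have sub: "verts D \<subseteq> verts D'" "arcs D \<subseteq> arcs D'" using D' by auto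
    then have "card (verts D) \<le> card (verts D')" "card (arcs D) \<le> card (arcs D')"
      by (auto intro: card_mono)
    then have "card (verts D) = card (verts D')" "card (arcs D) = card (arcs D')"
      using \<open>m D' \<le> m D\<close> by (simp_all add: m_def)
    then have "verts D = verts D'" "arcs D = arcs D'"
      using sub by (simp_all add: card_subset_eq)
    then show ?thesis using D'(1) by (auto simp: subgraph_def compatible_def)
  qed
  then show ?thesis using D by (auto simp: block_of_def P_def max_subgraph_def)
qed

text \<open>A path from \<open>x\<close> to \<open>y\<close> off \<open>z\<close> closes up through
  \<open>z\<close> to a cycle. The block containing this cycle is complete and contains
  \<open>x\<close> and \<open>y\<close>.\<close>

lemma block_graph_separates:
  assumes "block_graph G" "z \<rightarrow> x" "z \<rightarrow> y" "x \<noteq> y"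
    and "(\<lambda>u v. u \<rightarrow> v \<and> u \<noteq> z \<and> v \<noteq> z)\<^sup>*\<^sup>* x y"
  shows "x \<rightarrow> y"
proof -
  obtain f n where f: "f 0 = x" "f n = y" "\<And>i. i < n \<Longrightarrow> f i \<rightarrow> f (Suc i) \<and> f i \<noteq> z \<and> f (Suc i) \<noteq> z"
    "inj_on f {..n}"
    using rtranclp_injective_path[OF assms(5)] by metis
  let ?C = "G \<restriction> insert z (f ` {..n})"
  have nz: "f i \<noteq> z" if "i \<le> n" for i
    using that f(3)[of i] f(2) assms(3) adj_not_same by (cases "i = n") auto
  have "two_connected ?C"
    using two_connected_cycle[of z f n] f nz assms by blast
  moreover have "insert z (f ` {..n}) \<subseteq> verts G"
    using assms(2,3) f adj_in_verts by (auto simp: le_less dest!: f(3))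
  then have "subgraph ?C G" using induced_imp_subgraph by blast
  ultimately obtain D where D: "block_of D G" "subgraph ?C D" using two_connected_in_block by blast
  have "x \<in> verts ?C" "y \<in> verts ?C" using f(1,2) by force+
  then have "x \<in> verts D" "y \<in> verts D" using subgraph_imp_subverts[OF D(2)] by auto
  moreover have "complete_digraph (card (verts D)) D" using assms(1) D by (simp add: block_graph_def)
  ultimately have "x \<rightarrow>\<^bsub>D\<^esub> y" using assms(4) by (simp add: complete_digraph_def)
  moreover have "subgraph D G" using D(1) by (simp add: block_of_def max_subgraph_def)
  ultimately show ?thesis using adj_mono by blast
qed

end

text \<open>The walk is projected by \<open>\<pi>\<close> to the block graph. A vertex with another
  closed neighbourhood than \<open>c\<close> lies outside the fibre of \<open>c\<close>, so the
  projection avoids \<open>\<pi> c\<close>; steps inside one fibre become stationary.\<close>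

lemma extended_block_graph_separates:
  assumes "extended_block_graph B" and V: "c \<in> verts B" "a \<in> verts B" "b \<in> verts B"
    and "c \<rightarrow>\<^bsub>B\<^esub> a" "c \<rightarrow>\<^bsub>B\<^esub> b" "b \<notin> closed_nbhd B a"
  shows "\<not> (\<lambda>u v. u \<in> verts B \<and> v \<in> verts B \<and> v \<in> closed_nbhd B u \<and>
      closed_nbhd B u \<noteq> closed_nbhd B c \<and> closed_nbhd B v \<noteq> closed_nbhd B c)\<^sup>*\<^sup>* a b"
proof
  let ?R = "\<lambda>u v. u \<in> verts B \<and> v \<in> verts B \<and> v \<in> closed_nbhd B u \<and>
      closed_nbhd B u \<noteq> closed_nbhd B c \<and> closed_nbhd B v \<noteq> closed_nbhd B c"
  assume R: "?R\<^sup>*\<^sup>* a b"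
  obtain T :: "('a, 'b) pre_digraph" and \<pi> where T: "block_graph T" and "clique_replacement \<pi> T B"
    using assms by (auto simp: extended_block_graph_def)
  then have adj: "\<And>u v. u \<in> verts B \<Longrightarrow> v \<in> verts B \<Longrightarrow>
      u \<rightarrow>\<^bsub>B\<^esub> v \<longleftrightarrow> u \<noteq> v \<and> (\<pi> u = \<pi> v \<or> \<pi> u \<rightarrow>\<^bsub>T\<^esub> \<pi> v)"
    by (simp add: clique_replacement_def)
  interpret B: graph B using assms by (simp add: extended_block_graph_def)
  interpret T: graph T using T by (simp add: block_graph_def)
  have cn: "closed_nbhd B u = {v \<in> verts B. \<pi> u = \<pi> v \<or> \<pi> u \<rightarrow>\<^bsub>T\<^esub> \<pi> v}" if "u \<in> verts B" for u
  proof (rule set_eqI)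
    fix v
    show "v \<in> closed_nbhd B u \<longleftrightarrow> v \<in> {v \<in> verts B. \<pi> u = \<pi> v \<or> \<pi> u \<rightarrow>\<^bsub>T\<^esub> \<pi> v}"
      using that adj[OF that, of v] B.adj_in_verts(2)[of u v]
      by (cases "v \<in> verts B") (auto simp: closed_nbhd_def nbhd_def)
  qed
  have fibre: "\<pi> u \<noteq> \<pi> c" if "u \<in> verts B" "closed_nbhd B u \<noteq> closed_nbhd B c" for u
    using that cn V by auto
  let ?Q = "\<lambda>u v. u \<rightarrow>\<^bsub>T\<^esub> v \<and> u \<noteq> \<pi> c \<and> v \<noteq> \<pi> c"
  have "?Q\<^sup>*\<^sup>* (\<pi> a) (\<pi> b)"
    using R
  proof induction
    case (step u v)
    then have "\<pi> u = \<pi> v \<or> ?Q (\<pi> u) (\<pi> v)" using fibre cn by auto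
    then show ?case using step.IH rtranclp.rtrancl_into_rtrancl[OF step.IH, of "\<pi> v"] by auto
  qed simp
  moreover have nab: "\<pi> a \<noteq> \<pi> b" "\<not> \<pi> a \<rightarrow>\<^bsub>T\<^esub> \<pi> b" using assms(7) cn V by auto
  \<comment> \<open>Were \<open>c\<close> in the fibre of \<open>a\<close> or of \<open>b\<close>,
    its adjacency to the other one would make \<open>a\<close> and \<open>b\<close> near each
    other.\<close>
  moreover have "\<pi> c \<rightarrow>\<^bsub>T\<^esub> \<pi> a" "\<pi> c \<rightarrow>\<^bsub>T\<^esub> \<pi> b"
    using adj[of c a] adj[of c b] assms(5,6) V nab T.graph_symmetric by metis+
  ultimately show False using T.block_graph_separates[OF T] by blast
qed

section \<open>Graph distance\<close>

text \<open>A natural-number distance that replaces \<open>gdist\<close> in the arithmetic. It is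
  meaningful for \<open>v\<close> reachable from \<open>u\<close>, where the least length
  exists.\<close>

definition hops :: "('a, 'b) pre_digraph \<Rightarrow> 'a \<Rightarrow> 'a \<Rightarrow> nat" where
  "hops G u v = (LEAST n. (u, v) \<in> arcs_ends G ^^ n)"

lemma hops_le: "(u, v) \<in> arcs_ends G ^^ n \<Longrightarrow> hops G u v \<le> n"
  unfolding hops_def by (rule Least_le)

lemma hops_walk:
  assumes "u \<rightarrow>\<^sup>*\<^bsub>G\<^esub> v"
  shows "(u, v) \<in> arcs_ends G ^^ hops G u v"
proof -
  have "\<exists>n. (u, v) \<in> arcs_ends G ^^ n"
    using reachable_rtranclI[OF assms] by (auto simp: rtrancl_power)
  then show ?thesis unfolding hops_def by (rule LeastI_ex)
qed

lemma hops_self [simp]: "hops G u u = 0"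
  using hops_le[where n = 0 and u = u and v = u] by simp

lemma hops_eq_0_iff: "u \<rightarrow>\<^sup>*\<^bsub>G\<^esub> v \<Longrightarrow> hops G u v = 0 \<longleftrightarrow> u = v"
  using hops_walk[of G u v] by auto

lemma hops_le_1_iff: "u \<rightarrow>\<^sup>*\<^bsub>G\<^esub> v \<Longrightarrow> hops G u v \<le> 1 \<longleftrightarrow> v \<in> closed_nbhd G u"
  using hops_walk[of G u v] hops_le[where n = 1 and u = u and v = v and G = G]
  by (auto simp: closed_nbhd_def nbhd_def le_Suc_eq)

lemma hops_triangle:
  assumes "u \<rightarrow>\<^sup>*\<^bsub>G\<^esub> v" "v \<rightarrow>\<^sup>*\<^bsub>G\<^esub> w"
  shows "hops G u w \<le> hops G u v + hops G v w"
  using hops_walk[OF assms(1)] hops_walk[OF assms(2)] by (intro hops_le) (auto simp: relpow_add)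

context wf_digraph
begin

lemma awalk_imp_relpow: "awalk u p v \<Longrightarrow> (u, v) \<in> arcs_ends G ^^ length p"
proof (induction p arbitrary: u)
  case (Cons e p)
  then have "(u, head G e) \<in> arcs_ends G" "(head G e, v) \<in> arcs_ends G ^^ length p"
    by (auto simp: awalk_Cons_iff arcs_ends_conv)
  then show ?case by (auto intro: relpow_Suc_I2 simp del: relpow.simps)
qed (simp add: awalk_Nil_iff)

lemma relpow_imp_awalk:
  "(u, v) \<in> arcs_ends G ^^ n \<Longrightarrow> u \<in> verts G \<Longrightarrow> \<exists>p. awalk u p v \<and> length p = n"
proof (induction n arbitrary: u)
  case 0
  then show ?case by (auto simp: awalk_Nil_iff)
next
  case (Suc n)
  then obtain w where w: "u \<rightarrow> w" "(w, v) \<in> arcs_ends G ^^ n" by (meson relpow_Suc_D2)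
  then obtain e p where "e \<in> arcs G" "tail G e = u" "head G e = w" "awalk w p v" "length p = n"
    using Suc.IH adj_in_verts by (metis reachableE)
  then have "awalk u (e # p) v \<and> length (e # p) = Suc n" by (auto simp: awalk_Cons_iff)
  then show ?case by blast
qed

lemma gdist_eq_hops:
  assumes "u \<rightarrow>\<^sup>* v"
  shows "gdist G u v = ereal (real (hops G u v))"
proof -
  have cost: "awalk_cost (\<lambda>_. 1) p = real (length p)" for p :: "'b list"
    by (induction p) auto
  obtain p where p: "awalk u p v" "length p = hops G u v"
    using relpow_imp_awalk[OF hops_walk[OF assms] reachable_in_verts(1)[OF assms]] by blast
  show ?thesis
    unfolding gdist_def \<mu>_def
  proof (rule INF_eqI)
    fix q assume "q \<in> {p. awalk u p v}"
    then show "ereal (real (hops G u v)) \<le> ereal (awalk_cost (\<lambda>_. 1) q)"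
      using hops_le[OF awalk_imp_relpow] by (simp add: cost)
  next
    fix y assume "\<And>q. q \<in> {p. awalk u p v} \<Longrightarrow> y \<le> ereal (awalk_cost (\<lambda>_. 1) q)"
    from this[of p] show "y \<le> ereal (real (hops G u v))" using p by (simp add: cost)
  qed
qed

lemma hops_first_step:
  assumes "u \<rightarrow>\<^sup>* v" "u \<noteq> v"
  obtains w where "u \<rightarrow> w" "hops G u v = Suc (hops G w v)"
proof -
  obtain n where n: "hops G u v = Suc n" using hops_eq_0_iff assms by (metis not0_implies_Suc)
  then obtain w where w: "u \<rightarrow> w" "(w, v) \<in> arcs_ends G ^^ n"
    using hops_walk[OF assms(1)] by (metis relpow_Suc_D2)
  have "(w, v) \<in> arcs_ends G ^^ hops G w v"
    unfolding hops_def using w(2) by (rule LeastI)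
  then have "hops G u v \<le> Suc (hops G w v)" using w(1) by (meson hops_le relpow_Suc_I2)
  moreover have "hops G w v \<le> n" using w by (rule_tac hops_le)
  ultimately show ?thesis using that w n by simp
qed

end

lemma relpow_sym: "sym R \<Longrightarrow> (u, v) \<in> R ^^ n \<Longrightarrow> (v, u) \<in> R ^^ n"
  by (induction n arbitrary: v) (auto intro: relpow_Suc_I2 dest: symD simp del: relpow.simps(2) elim!: relpow_Suc_E)

lemma (in graph) hops_sym: "hops G u v = hops G v u"
proof -
  have "sym (arcs_ends G)" using sym_arcs by (simp add: symmetric_def)
  then have "(u, v) \<in> arcs_ends G ^^ n \<longleftrightarrow> (v, u) \<in> arcs_ends G ^^ n" for n
    using relpow_sym by metis
  then show ?thesis by (simp add: hops_def)
qed

lemma (in wf_digraph) hops_app_iso: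
  assumes "digraph_isomorphism hom" "u \<in> verts G" "v \<in> verts G"
  shows "hops (app_iso hom G) (iso_verts hom u) (iso_verts hom v) = hops G u v"
proof -
  let ?f = "iso_verts hom"
  have ends: "arcs_ends (app_iso hom G) = (\<lambda>(u, v). (?f u, ?f v)) ` arcs_ends G"
    using arcs_ends_app_iso_eq assms by blast
  have "(?f u, ?f v) \<in> arcs_ends (app_iso hom G) ^^ n \<longleftrightarrow> (u, v) \<in> arcs_ends G ^^ n" for n
    using assms(3)
  proof (induction n arbitrary: v)
    case 0
    then show ?case using assms by simp
  next
    case (Suc n)
    show ?case
    proof
      assume "(?f u, ?f v) \<in> arcs_ends (app_iso hom G) ^^ Suc n"
      then obtain w where "(?f u, w) \<in> arcs_ends (app_iso hom G) ^^ n" "(w, ?f v) \<in> arcs_ends (app_iso hom G)"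
        by auto
      moreover then obtain w' v' where "w = ?f w'" "?f v = ?f v'" "w' \<rightarrow> v'" using ends by auto
      ultimately show "(u, v) \<in> arcs_ends G ^^ Suc n"
        using Suc assms adj_in_verts by auto
    next
      assume "(u, v) \<in> arcs_ends G ^^ Suc n"
      then obtain w where "(u, w) \<in> arcs_ends G ^^ n" "w \<rightarrow> v" by auto
      moreover then have "(?f w, ?f v) \<in> arcs_ends (app_iso hom G)" using ends by force
      ultimately show "(?f u, ?f v) \<in> arcs_ends (app_iso hom G) ^^ Suc n"
        using Suc.IH adj_in_verts by auto
    qed
  qed
  then show ?thesis by (simp add: hops_def)
qed

lemma (in graph) connected_reachable:
  assumes "connected G" "u \<in> verts G" "v \<in> verts G"
  shows "u \<rightarrow>\<^sup>* v"
  using symmetric_connected_imp_strongly_connected[OF sym_arcs assms(1)] assms(2,3)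
  by (simp add: strongly_connected_def)

lemma induced_subgraph_adj_iff:
  assumes "induced_subgraph B G" "u \<in> verts B" "v \<in> verts B"
  shows "u \<rightarrow>\<^bsub>B\<^esub> v \<longleftrightarrow> u \<rightarrow>\<^bsub>G\<^esub> v"
  using assms by (force simp: induced_subgraph_def subgraph_def compatible_def arcs_ends_conv)

section \<open>Vertebrate graphs\<close>

text \<open>Every condition of the locale is checked in \<open>H\<close> and carried to the host by
  \<open>dist\<close>, which combines invariance under the isomorphism with isometry of the
  copy.\<close>

lemma isometric_copy_spine:
  assumes "vertebrate H" and G: "graph G" "connected G"
    and hom: "pre_digraph.digraph_isomorphism H hom" and iso: "isometric_subgraph (app_iso hom H) G"
  obtains B where "B \<noteq> {}" "spine (verts G) (verts (app_iso hom H)) B (hops G)"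
proof -
  interpret G: graph G by fact
  interpret H: graph H using assms by (simp add: vertebrate_def)
  obtain B where B: "induced_subgraph B H" "extended_block_graph B"
    and vert: "\<And>c x. c \<in> verts B \<Longrightarrow> x \<in> verts H \<Longrightarrow> gdist H c x \<ge> 2 \<Longrightarrow>
           \<exists>c'\<in>nbhd_towards H c x \<inter> verts B.
              \<forall>v\<in>nbhd_towards H c x. closed_nbhd H v \<subseteq> closed_nbhd H c'"
    using assms(1) by (auto simp: vertebrate_def)
  let ?f = "iso_verts hom"
  let ?K = "app_iso hom H"
  have reachG: "u \<rightarrow>\<^sup>*\<^bsub>G\<^esub> v" if "u \<in> verts G" "v \<in> verts G" for u v
    using G.connected_reachable G that by blast
  have reachH: "u \<rightarrow>\<^sup>*\<^bsub>H\<^esub> v" if "u \<in> verts H" "v \<in> verts H" for u v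
    using H.connected_reachable that assms(1) by (simp add: vertebrate_def)
  interpret K: wf_digraph ?K using H.wf_digraphI_app_iso hom by blast
  have KG: "verts ?K \<subseteq> verts G"
    using iso subgraph_imp_subverts induced_imp_subgraph unfolding isometric_subgraph_def by blast
  have dist: "hops G (?f u) (?f v) = hops H u v" if "u \<in> verts H" "v \<in> verts H" for u v
  proof -
    have uv: "?f u \<in> verts ?K" "?f v \<in> verts ?K" using that by auto
    then have "gdist ?K (?f u) (?f v) = gdist G (?f u) (?f v)"
      using iso by (simp add: isometric_subgraph_def del: verts_app_iso)
    also have "\<dots> = ereal (real (hops G (?f u) (?f v)))"
      using G.gdist_eq_hops reachG uv KG by blast
    finally have g: "gdist ?K (?f u) (?f v) = ereal (real (hops G (?f u) (?f v)))" .
    \<comment> \<open>Distance in the copy equals a distance in the connected host, so it is finite;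
      this yields reachability inside the copy.\<close>
    then have "?f u \<rightarrow>\<^sup>*\<^bsub>?K\<^esub> ?f v"
      using K.shortest_path_inf[of "?f u" "?f v" "\<lambda>_. 1"] by (auto simp: gdist_def)
    then have "hops ?K (?f u) (?f v) = hops G (?f u) (?f v)"
      using K.gdist_eq_hops g by simp
    then show ?thesis using H.hops_app_iso[OF hom that] by simp
  qed
  have BH: "verts B \<subseteq> verts H" using B(1) by (auto dest: induced_imp_subgraph subgraph_imp_subverts)
  have near: "hops H u v \<le> 1 \<longleftrightarrow> v \<in> closed_nbhd H u" if "u \<in> verts H" "v \<in> verts H" for u v
    by (rule hops_le_1_iff) (rule reachH[OF that])
  have nbhdH: "v \<in> nbhd H u \<longleftrightarrow> v \<in> verts H \<and> hops H u v = 1" if "u \<in> verts H" for u v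
  proof (cases "v \<in> verts H")
    case True
    have "u \<noteq> v" if "v \<in> nbhd H u" using that H.adj_not_same by (auto simp: nbhd_def)
    then show ?thesis
      using near[OF \<open>u \<in> verts H\<close> True] hops_eq_0_iff[OF reachH[OF \<open>u \<in> verts H\<close> True]] True
      by (auto simp: closed_nbhd_def le_Suc_eq)
  qed (use H.adj_in_verts in \<open>auto simp: nbhd_def\<close>)
  have towards: "v \<in> nbhd_towards H c x \<longleftrightarrow> v \<in> verts H \<and> hops H c v = 1 \<and> hops H c x = Suc (hops H v x)"
    if "c \<in> verts H" "x \<in> verts H" for c x v
  proof (cases "v \<in> verts H")
    case True
    have "gdist H c x = 1 + gdist H v x \<longleftrightarrow> hops H c x = Suc (hops H v x)"
      using H.gdist_eq_hops reachH that True by (auto simp: one_ereal_def)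
    then show ?thesis using nbhdH that True by (auto simp: nbhd_towards_def)
  qed (use nbhdH that in \<open>auto simp: nbhd_towards_def\<close>)
  have nearB: "v \<in> closed_nbhd B u \<longleftrightarrow> v \<in> verts B \<and> hops H u v \<le> 1" if "u \<in> verts B" for u v
  proof -
    interpret B: graph B using B(2) by (simp add: extended_block_graph_def)
    show ?thesis
      using induced_subgraph_adj_iff[OF B(1) that, of v] near[of u v] BH that B.adj_in_verts(2)[of u v]
      by (cases "v \<in> verts B") (auto simp: closed_nbhd_def nbhd_def)
  qed
  have "spine (verts G) (verts ?K) (?f ` verts B) (hops G)"
  proof
    show "finite (verts G)" by simp
    show "verts ?K \<subseteq> verts G" by (rule KG)
    show "?f ` verts B \<subseteq> verts ?K" using BH by auto
    show "hops G x y = 0 \<longleftrightarrow> x = y" if "x \<in> verts G" "y \<in> verts G" for x y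
      by (rule hops_eq_0_iff) (rule reachG[OF that])
    show "hops G x y = hops G y x" for x y by (rule G.hops_sym)
    show "hops G x z \<le> hops G x y + hops G y z"
      if "x \<in> verts G" "y \<in> verts G" "z \<in> verts G" for x y z
      by (rule hops_triangle) (use reachG that in auto)
    show "\<exists>z\<in>verts ?K. hops G x z = 1 \<and> hops G x y = Suc (hops G z y)"
      if xy: "x \<in> verts ?K" "y \<in> verts ?K" "x \<noteq> y" for x y
    proof -
      obtain u v where uv: "u \<in> verts H" "v \<in> verts H" "x = ?f u" "y = ?f v" using xy by auto
      then obtain w where "u \<rightarrow>\<^bsub>H\<^esub> w" "hops H u v = Suc (hops H w v)"
        using H.hops_first_step[of u v] reachH xy by blast
      moreover then have "w \<in> verts H" "hops H u w = 1" using nbhdH uv by (auto simp: nbhd_def)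
      ultimately show ?thesis using uv dist by (intro bexI[of _ "?f w"]) auto
    qed
    show "\<exists>g\<in>?f ` verts B. hops G c g = 1 \<and> hops G c x = Suc (hops G g x) \<and>
            (\<forall>v\<in>verts ?K. hops G c v = 1 \<and> hops G c x = Suc (hops G v x) \<longrightarrow>
               (\<forall>u\<in>verts ?K. hops G v u \<le> 1 \<longrightarrow> hops G g u \<le> 1))"
      if cx: "c \<in> ?f ` verts B" "x \<in> verts ?K" "hops G c x \<ge> 2" for c x
    proof -
      obtain u v where uv: "u \<in> verts B" "v \<in> verts H" "c = ?f u" "x = ?f v" using cx by auto
      then have uH: "u \<in> verts H" using BH by auto
      then have "gdist H u v \<ge> 2"
        using cx(3) dist[of u v] uv H.gdist_eq_hops[OF reachH[of u v]]
          ereal_less_eq(3)[of 2 "real (hops H u v)"] by simp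
      then obtain g where g: "g \<in> nbhd_towards H u v" "g \<in> verts B"
        "\<And>w. w \<in> nbhd_towards H u v \<Longrightarrow> closed_nbhd H w \<subseteq> closed_nbhd H g"
        using vert uv by blast
      have "hops H g t \<le> 1"
        if "w \<in> verts H" "hops H u w = 1" "hops H u v = Suc (hops H w v)" "t \<in> verts H" "hops H w t \<le> 1" for w t
        using g(3)[of w] towards[OF uH uv(2), of w] near[of w t] near[of g t] that g(2) BH by blast
      moreover have "hops H u g = 1" "hops H u v = Suc (hops H g v)"
        using g(1) towards uH uv by auto
      ultimately show ?thesis
        using g(2) BH uv uH dist by (intro bexI[of _ "?f g"]) (auto simp: subset_iff)
    qed
    show "\<not> (\<lambda>u v. u \<in> ?f ` verts B \<and> v \<in> ?f ` verts B \<and> hops G u v \<le> 1 \<and>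
           (\<exists>t\<in>?f ` verts B. (hops G u t \<le> 1) \<noteq> (hops G c t \<le> 1)) \<and>
           (\<exists>t\<in>?f ` verts B. (hops G v t \<le> 1) \<noteq> (hops G c t \<le> 1)))\<^sup>*\<^sup>* a b"
      if cab: "c \<in> ?f ` verts B" "a \<in> ?f ` verts B" "b \<in> ?f ` verts B"
        "hops G c a = 1" "hops G c b = 1" "hops G a b \<ge> 2" for c a b
    proof
      let ?R = "\<lambda>u v. u \<in> ?f ` verts B \<and> v \<in> ?f ` verts B \<and> hops G u v \<le> 1 \<and>
           (\<exists>t\<in>?f ` verts B. (hops G u t \<le> 1) \<noteq> (hops G c t \<le> 1)) \<and>
           (\<exists>t\<in>?f ` verts B. (hops G v t \<le> 1) \<noteq> (hops G c t \<le> 1))"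
      assume R: "?R\<^sup>*\<^sup>* a b"
      obtain c' a' b' where c': "c' \<in> verts B" "a' \<in> verts B" "b' \<in> verts B"
        "c = ?f c'" "a = ?f a'" "b = ?f b'" using cab by auto
      let ?Q = "\<lambda>u v. u \<in> verts B \<and> v \<in> verts B \<and> v \<in> closed_nbhd B u \<and>
          closed_nbhd B u \<noteq> closed_nbhd B c' \<and> closed_nbhd B v \<noteq> closed_nbhd B c'"
      have distB: "hops G (?f u) (?f v) = hops H u v" if "u \<in> verts B" "v \<in> verts B" for u v
        using dist BH that by blast
      have twin: "closed_nbhd B u \<noteq> closed_nbhd B c'"
        if u: "u \<in> verts B" "\<exists>t\<in>?f ` verts B. (hops G (?f u) t \<le> 1) \<noteq> (hops G c t \<le> 1)" for u
      proof -
        obtain t where "t \<in> verts B" "(hops H u t \<le> 1) \<noteq> (hops H c' t \<le> 1)"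
          using u c' distB by auto
        then show ?thesis using nearB u(1) c'(1) by blast
      qed
      \<comment> \<open>The walk in the copy is pulled back step by step to a walk in
        \<open>B\<close>; injectivity of \<open>?f\<close> later identifies its end with
        \<open>b'\<close>.\<close>
      have "\<exists>v'\<in>verts B. v = ?f v' \<and> ?Q\<^sup>*\<^sup>* a' v'" if "?R\<^sup>*\<^sup>* a v" for v
        using that
      proof induction
        case base
        then show ?case using c' by blast
      next
        case (step v w)
        then obtain v' w' where vw: "v' \<in> verts B" "v = ?f v'" "?Q\<^sup>*\<^sup>* a' v'" "w' \<in> verts B" "w = ?f w'"
          by blast
        have "w' \<in> closed_nbhd B v'" using step.hyps(2) vw distB nearB by simp
        moreover have "closed_nbhd B v' \<noteq> closed_nbhd B c'" "closed_nbhd B w' \<noteq> closed_nbhd B c'"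
          using step.hyps(2) vw twin by auto
        ultimately have "?Q v' w'" using vw by blast
        then have "?Q\<^sup>*\<^sup>* a' w'" by (rule rtranclp.rtrancl_into_rtrancl[OF vw(3)])
        then show ?case using vw by blast
      qed
      from this[OF R] obtain b'' where b'': "b'' \<in> verts B" "b = ?f b''" "?Q\<^sup>*\<^sup>* a' b''" by blast
      then have "b'' = b'" using c' BH H.iso_verts_eq_iff[OF hom] by (metis subsetD)
      then have "?Q\<^sup>*\<^sup>* a' b'" using b'' by simp
      moreover have "c' \<rightarrow>\<^bsub>B\<^esub> a'" "c' \<rightarrow>\<^bsub>B\<^esub> b'"
        using induced_subgraph_adj_iff[OF B(1)] cab(4,5) c' distB nbhdH[of c'] BH
        by (auto simp: nbhd_def subset_iff)
      moreover have "b' \<notin> closed_nbhd B a'" using nearB c' cab(6) distB by auto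
      ultimately show False
        using extended_block_graph_separates[OF B(2) c'(1-3)] by blast
    qed
  qed
  moreover have "verts B \<noteq> {}"
  proof -
    obtain T :: "('a, 'b) pre_digraph" and \<pi> where "connected T" "\<pi> ` verts B = verts T"
      using B(2) by (auto simp: extended_block_graph_def block_graph_def clique_replacement_def)
    then show ?thesis by (auto simp: connected_def strongly_connected_def)
  qed
  ultimately show ?thesis using that[of "?f ` verts B"] by simp
qed

lemma spine_guardable:
  assumes G: "graph G" "connected G" and "B \<noteq> {}" and sp: "spine (verts G) (verts K) B (hops G)"
  shows "one_cop_guards K G"
proof -
  interpret G: graph G by fact
  interpret spine "verts G" "verts K" B "hops G" by fact
  have near: "hops G u v \<le> 1 \<longleftrightarrow> v \<in> closed_nbhd G u" if "u \<in> verts G" "v \<in> verts G" for u v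
    by (rule hops_le_1_iff) (rule G.connected_reachable[OF G(2) that])
  obtain c0 where c0: "c0 \<in> B" using assms by blast
  \<comment> \<open>Folding \<open>cop_step\<close> over the robber's history turns the move rule,
    which needs only the two current positions, into a strategy on lists.\<close>
  define \<sigma> where "\<sigma> = foldl cop_step c0"
  have pos: "cop_pos \<sigma> r 0 = c0" "cop_pos \<sigma> r (Suc t) = cop_step (cop_pos \<sigma> r t) (r t)" for r t
    by (simp_all add: cop_pos_def \<sigma>_def)
  have posV: "cop_pos \<sigma> r t \<in> verts G" for r t
    by (induction t) (use c0 B_V cop_step_legal pos in auto)
  have "cop_strategy G \<sigma>"
    using posV near cop_step_legal by (simp add: cop_strategy_def legal_step_def pos)
  moreover obtain N where N: "\<And>c r t. c 0 \<in> B \<Longrightarrow> (\<And>s. c (Suc s) = cop_step (c s) (r s)) \<Longrightarrow>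
      (\<And>s. r s \<in> verts G) \<Longrightarrow> (\<And>s. hops G (r s) (r (Suc s)) \<le> 1) \<Longrightarrow> t \<ge> N \<Longrightarrow>
      (\<And>s. s < t \<Longrightarrow> c (Suc s) \<noteq> r s) \<Longrightarrow>
      c t \<in> B \<and> (r t \<in> verts K \<longrightarrow> c (Suc t) = r t)"
    using cop_step_guards by blast
  moreover have "cop_pos \<sigma> r t \<in> verts K \<and> (r t \<in> verts K \<longrightarrow> cop_pos \<sigma> r (Suc t) = r t)"
    if r: "robber_play G r" and t: "N \<le> t" "\<not> captured \<sigma> r t" for r t
  proof -
    have rV: "r s \<in> verts G" for s using r by (simp add: robber_play_def legal_step_def)
    have step: "hops G (r s) (r (Suc s)) \<le> 1" for s
      using r near rV by (simp add: robber_play_def legal_step_def)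
    have "cop_pos \<sigma> r t \<in> B \<and> (r t \<in> verts K \<longrightarrow> cop_pos \<sigma> r (Suc t) = r t)"
      \<comment> \<open>Since the robber is not yet captured, no cop move up to round
        \<open>t\<close> has landed on it.\<close>
      by (rule N) (use rV step t c0 in \<open>auto simp: pos captured_def\<close>)
    then show ?thesis using B_H by blast
  qed
  ultimately show ?thesis unfolding one_cop_guards_def by blast
qed

theorem theorem8:
  fixes H :: "('a, 'b) pre_digraph"
  assumes "vertebrate H"
  shows "one_guardable TYPE('c \<times> 'd) H"
  unfolding one_guardable_def
proof (intro allI impI)
  fix G :: "('c, 'd) pre_digraph" and K
  assume A: "graph G \<and> connected G \<and> digraph_iso H K \<and> isometric_subgraph K G"
  then obtain hom where hom: "pre_digraph.digraph_isomorphism H hom" "K = app_iso hom H"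
    by (auto simp: digraph_iso_def)
  then obtain B where "B \<noteq> {}" "spine (verts G) (verts K) B (hops G)"
    using isometric_copy_spine[OF assms] A by metis
  then show "one_cop_guards K G" using spine_guardable A by blast
qed

end
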